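(* Let $\mathcal{H}$ be a Hilbert space, let $H\ge 0$ be a selfadjoint operator in $\mathcal{H}$, and let $V\ge 0$ be a bounded selfadjoint operator on $\mathcal{H}$. For $E>0$ let $P_E=\mathbf{1}_{[0,E]}(H)$. The following are equivalent: (i) $H+V\gg 0$, i.e. there is $\varepsilon>0$ with $((H+V)f|f)\ge \varepsilon\|f\|^2$ for all $f\in\mathrm{dom}(H)$; (ii) there exist $E_1>0$ and $\kappa>0$ such that $P_{E_1}VP_{E_1}\ge \kappa P_{E_1}$; (iii) there exist $E_2>0$ and $\mu>0$ such that for every $f\in\mathrm{dom}(H)$ with $(Hf|f)\le E_2\|f\|^2$ one has $(Vf|f)\ge \mu\|f\|^2$.
   Context: $(\cdot|\cdot)$ is the inner product of $\mathcal{H}$; $H$ may be unbounded. For a selfadjoint operator $A$ and $\varepsilon\in\mathbb{R}$, $A\ge\varepsilon$ means $(Af|f)\ge\varepsilon(f|f)$ for all $f\in\mathrm{dom}(A)$, equivalently $\sigma(A)\subset[\varepsilon,\infty)$. $A\gg0$ ("strictly positive") means $A\ge\varepsilon$ for some $\varepsilon>0$. For bounded selfadjoint operators, $A\ge B$ means $A-B\ge0$. $P_E=\mathbf{1}_{[0,E]}(H)$ is the spectral projector of $H$ associated with $[0,E]$. The operator $H+V$ has domain $\mathrm{dom}(H)$. *)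

theory Defs
  imports "HOL-Analysis.Analysis"
begin

text \<open>
  Complex Hilbert spaces. The library only has real inner product spaces, so the complex
  structure is put on top of \<^class>\<open>real_inner\<close>: the real inner product is the real part of
  the complex one, hence the norm, the topology and completeness are those of the library.
  The complex inner product is antilinear in its first argument.
\<close>

class complex_hilbert = real_inner + complete_space +
  fixes scaleC :: "complex \<Rightarrow> 'a \<Rightarrow> 'a" (infixr "*\<^sub>C" 75)
    and cinner :: "'a \<Rightarrow> 'a \<Rightarrow> complex"
  assumes scaleC_add_right: "c *\<^sub>C (x + y) = c *\<^sub>C x + c *\<^sub>C y"
    and scaleC_add_left: "(c + d) *\<^sub>C x = c *\<^sub>C x + d *\<^sub>C x"
    and scaleC_scaleC: "c *\<^sub>C d *\<^sub>C x = (c * d) *\<^sub>C x"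
    and scaleC_of_real: "complex_of_real r *\<^sub>C x = r *\<^sub>R x"
    and cinner_commute: "cinner x y = cnj (cinner y x)"
    and cinner_add_left: "cinner (x + y) z = cinner x z + cinner y z"
    and cinner_scaleC_left: "cinner (c *\<^sub>C x) y = cnj c * cinner x y"
    and inner_eq_Re_cinner: "inner x y = Re (cinner x y)"

definition csubspace :: "'a::complex_hilbert set \<Rightarrow> bool" where
  "csubspace D \<longleftrightarrow> 0 \<in> D \<and> (\<forall>x\<in>D. \<forall>y\<in>D. x + y \<in> D) \<and> (\<forall>c. \<forall>x\<in>D. c *\<^sub>C x \<in> D)"

definition clinear_on :: "'a::complex_hilbert set \<Rightarrow> ('a \<Rightarrow> 'a) \<Rightarrow> bool" where
  "clinear_on D A \<longleftrightarrow>
     (\<forall>x\<in>D. \<forall>y\<in>D. A (x + y) = A x + A y) \<and> (\<forall>c. \<forall>x\<in>D. A (c *\<^sub>C x) = c *\<^sub>C A x)"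

text \<open>
  A possibly unbounded operator is given by its domain \<open>D\<close> and a function \<open>A\<close> of which only the
  values on \<open>D\<close> matter. An everywhere defined operator has domain \<^term>\<open>UNIV\<close>.
\<close>

definition densely_defined_operator :: "'a::complex_hilbert set \<Rightarrow> ('a \<Rightarrow> 'a) \<Rightarrow> bool" where
  "densely_defined_operator D A \<longleftrightarrow> csubspace D \<and> closure D = UNIV \<and> clinear_on D A"

definition adjoint_dom :: "'a::complex_hilbert set \<Rightarrow> ('a \<Rightarrow> 'a) \<Rightarrow> 'a set" where
  "adjoint_dom D A = {g. \<exists>h. \<forall>f\<in>D. cinner (A f) g = cinner f h}"

definition adjoint_op :: "'a::complex_hilbert set \<Rightarrow> ('a \<Rightarrow> 'a) \<Rightarrow> 'a \<Rightarrow> 'a" where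
  "adjoint_op D A g = (THE h. \<forall>f\<in>D. cinner (A f) g = cinner f h)"

definition selfadjoint :: "'a::complex_hilbert set \<Rightarrow> ('a \<Rightarrow> 'a) \<Rightarrow> bool" where
  "selfadjoint D A \<longleftrightarrow> densely_defined_operator D A \<and>
     adjoint_dom D A = D \<and> (\<forall>g\<in>D. adjoint_op D A g = A g)"

definition bounded_selfadjoint :: "('a::complex_hilbert \<Rightarrow> 'a) \<Rightarrow> bool" where
  "bounded_selfadjoint A \<longleftrightarrow> bounded_linear A \<and> selfadjoint UNIV A"

text \<open>
  For selfadjoint \<open>A\<close> the number \<open>(Af|f)\<close> is real; \<^const>\<open>Re\<close> below only changes its type.
\<close>

definition op_ge :: "'a::complex_hilbert set \<Rightarrow> ('a \<Rightarrow> 'a) \<Rightarrow> real \<Rightarrow> bool" where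
  "op_ge D A \<epsilon> \<longleftrightarrow> (\<forall>f\<in>D. Re (cinner (A f) f) \<ge> \<epsilon> * (norm f)\<^sup>2)"

definition strictly_positive :: "'a::complex_hilbert set \<Rightarrow> ('a \<Rightarrow> 'a) \<Rightarrow> bool" where
  "strictly_positive D A \<longleftrightarrow> (\<exists>\<epsilon>>0. op_ge D A \<epsilon>)"

definition bounded_op_ge :: "('a::complex_hilbert \<Rightarrow> 'a) \<Rightarrow> ('a \<Rightarrow> 'a) \<Rightarrow> bool" where
  "bounded_op_ge A B \<longleftrightarrow> op_ge UNIV (\<lambda>f. A f - B f) 0"

definition orthogonal_projection :: "('a::complex_hilbert \<Rightarrow> 'a) \<Rightarrow> bool" where
  "orthogonal_projection P \<longleftrightarrow> bounded_selfadjoint P \<and> P \<circ> P = P"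

definition projection_valued_measure :: "(real set \<Rightarrow> 'a::complex_hilbert \<Rightarrow> 'a) \<Rightarrow> bool" where
  "projection_valued_measure Q \<longleftrightarrow>
     (\<forall>B\<in>sets borel. orthogonal_projection (Q B)) \<and>
     Q UNIV = id \<and>
     (\<forall>B :: nat \<Rightarrow> real set. range B \<subseteq> sets borel \<longrightarrow> disjoint_family B \<longrightarrow>
        (\<forall>f. (\<lambda>n. Q (B n) f) sums Q (\<Union>n. B n) f))"

definition scalar_measure :: "(real set \<Rightarrow> 'a::complex_hilbert \<Rightarrow> 'a) \<Rightarrow> 'a \<Rightarrow> real measure" where
  "scalar_measure Q f = measure_of UNIV (sets borel) (\<lambda>B. ennreal (Re (cinner (Q B f) f)))"

text \<open>
  \<open>Q\<close> is a spectral measure of the operator \<open>A\<close> with domain \<open>D\<close>, that is \<open>A = \<integral> x dQ(x)\<close>: the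
  domain is the set of \<open>f\<close> with \<open>\<integral> x\<^sup>2 d(Q f|f) < \<infinity>\<close>, and \<open>(Af|f) = \<integral> x d(Q f|f)\<close> on it, which
  determines \<open>A\<close> by polarization.
\<close>

definition is_spectral_measure ::
    "'a::complex_hilbert set \<Rightarrow> ('a \<Rightarrow> 'a) \<Rightarrow> (real set \<Rightarrow> 'a \<Rightarrow> 'a) \<Rightarrow> bool" where
  "is_spectral_measure D A Q \<longleftrightarrow>
     projection_valued_measure Q \<and>
     D = {f. integrable (scalar_measure Q f) (\<lambda>x. x\<^sup>2)} \<and>
     (\<forall>f\<in>D. cinner (A f) f = complex_of_real (\<integral>x. x \<partial>scalar_measure Q f))"

text \<open>
  The spectral projector \<open>1\<^bsub>B\<^esub>(A)\<close>. By the spectral theorem a selfadjoint operator has a spectral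
  measure, and it is unique on Borel sets; the choice operator (rather than a definite description)
  is needed only because \<open>Q\<close> is arbitrary outside the Borel sets.
\<close>

definition spectral_projector ::
    "'a::complex_hilbert set \<Rightarrow> ('a \<Rightarrow> 'a) \<Rightarrow> real set \<Rightarrow> 'a \<Rightarrow> 'a" where
  "spectral_projector D A B = (SOME Q. is_spectral_measure D A Q) B"

end

theory Submission imports Defs "HOL-Probability.Distribution_Functions" begin

text \<open>
  The equivalence itself is short. Write \<open>P\<close> for \<open>P\<^sub>E\<close> and split \<open>f = P f + g\<close>. (i) implies (iii) with
  \<open>E\<^sub>2 = \<mu> = \<epsilon> / 2\<close>. (iii) implies (ii) because \<open>P f\<close> lies in the domain of \<open>H\<close> and has energy at most
  \<open>E \<parallel>P f\<parallel>\<^sup>2\<close>. (ii) implies (i) because \<open>(H f | f) \<ge> E \<parallel>g\<parallel>\<^sup>2\<close>, and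
  \<open>(V f | f) \<ge> (V P f | P f) / 2 - (V g | g) \<ge> \<kappa> \<parallel>P f\<parallel>\<^sup>2 / 2 - \<parallel>V\<parallel> \<parallel>g\<parallel>\<^sup>2\<close>; replacing \<open>V\<close> by \<open>s V\<close>
  with a small \<open>s\<close> lets the first bound absorb the negative term. All this uses only that \<open>P\<close> comes
  from some spectral measure of \<open>H\<close>, not that the spectral measure is unique.

  What remains is the spectral theorem for \<open>H\<close>: a spectral measure exists
  (\<open>is_spectral_measure_Q\<close>). The bounded operator \<open>R = H (1 + H)\<^sup>-\<^sup>1\<close> satisfies \<open>0 \<le> R \<le> 1\<close>, and the
  spectral subspace of \<open>R\<close> for \<open>[0,r]\<close> can be described without any functional calculus as the set of
  all \<open>f\<close> with \<open>\<parallel>R\<^sup>n f\<parallel> = O(r\<^sup>n)\<close> (an idea of Leinfelder). These subspaces are visibly increasing and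
  right continuous in \<open>r\<close>. That \<open>R \<ge> r\<close> holds on the orthogonal complement (\<open>high_ineq\<close>) needs one
  operator square root, which a norm convergent iteration provides (\<open>symmetric_sqrt_exists\<close>). So \<open>H\<close>
  has a spectral family \<open>F\<close>. The Stieltjes measures of \<open>a \<mapsto> \<parallel>F a f\<parallel>\<^sup>2\<close> are, on every Borel set, the
  quadratic form of an orthogonal projection by a Dynkin system argument
  (\<open>spectral_projection_exists\<close>). On the range of \<open>F b - F a\<close> the operator \<open>H\<close> lies between \<open>a\<close> and
  \<open>b\<close>; refining partitions turns this into \<open>(H f | f) = \<integral> x d\<mu>\<close> and \<open>\<parallel>H f\<parallel>\<^sup>2 = \<integral> x\<^sup>2 d\<mu>\<close> for
  \<open>f\<close> in the range of some \<open>F b\<close> (\<open>spectral_integral\<close>). Letting \<open>b\<close> grow then identifies the domain of \<open>H\<close>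
  and the form of \<open>H\<close> on it.
\<close>

section \<open>Orthogonal projections in a Hilbert space\<close>

text \<open>The projection theorem: a minimizing sequence is Cauchy by the parallelogram law.\<close>

lemma nearest_point_exists:
  fixes M :: "'a::{real_inner,banach} set"
  assumes sub: "subspace M" and cl: "closed M"
  shows "\<exists>y\<in>M. \<forall>z\<in>M. inner (x - y) z = 0"
proof -
  define S where "S = (\<lambda>z. (norm (x - z))\<^sup>2) ` M"
  define d where "d = Inf S"
  have ne: "S \<noteq> {}" unfolding S_def using subspace_0[OF sub] by auto
  have bdd: "bdd_below S" unfolding S_def by (auto intro!: bdd_belowI[of _ 0])
  have lower: "d \<le> (norm (x - z))\<^sup>2" if "z \<in> M" for z
    unfolding d_def by (rule cInf_lower[OF _ bdd]) (use that S_def in auto)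
  have "\<exists>z\<in>M. (norm (x - z))\<^sup>2 < d + inverse (real (Suc n))" for n
    using cInf_lessD[OF ne, of "d + inverse (real (Suc n))"] unfolding d_def S_def by auto
  then obtain y where yM: "\<And>n. y n \<in> M"
    and y: "\<And>n. (norm (x - y n))\<^sup>2 < d + inverse (real (Suc n))" by metis
  have close: "(norm (y n - y m))\<^sup>2 \<le> 2 * inverse (real (Suc n)) + 2 * inverse (real (Suc m))" for n m
  proof -
    have "(1/2) *\<^sub>R (y n + y m) \<in> M"
      using yM by (intro subspace_scale[OF sub] subspace_add[OF sub])
    then have "d \<le> (norm (x - (1/2) *\<^sub>R (y n + y m)))\<^sup>2" by (rule lower)
    moreover have "(norm (y n - y m))\<^sup>2 =
        2 * (norm (x - y n))\<^sup>2 + 2 * (norm (x - y m))\<^sup>2 - 4 * (norm (x - (1/2) *\<^sub>R (y n + y m)))\<^sup>2"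
      by (simp add: power2_norm_eq_inner algebra_simps inner_commute)
    ultimately show ?thesis using y[of n] y[of m] by linarith
  qed
  have "Cauchy y"
  proof (rule metric_CauchyI)
    fix e :: real assume e: "0 < e"
    then obtain N where N: "inverse (real (Suc N)) < e\<^sup>2 / 4"
      using reals_Archimedean[of "e\<^sup>2 / 4"] by auto
    show "\<exists>M. \<forall>m\<ge>M. \<forall>n\<ge>M. dist (y m) (y n) < e"
    proof (intro exI allI impI)
      fix m n assume mn: "N \<le> m" "N \<le> n"
      have inv: "inverse (real (Suc k)) \<le> inverse (real (Suc N))" if "N \<le> k" for k
        using that by (intro le_imp_inverse_le) auto
      have "(norm (y m - y n))\<^sup>2 < e\<^sup>2"
        using close[of m n] N inv[OF mn(1)] inv[OF mn(2)] by linarith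
      then show "dist (y m) (y n) < e"
        using e by (simp add: dist_norm power_less_imp_less_base)
    qed
  qed
  then obtain l where l: "y \<longlonglongrightarrow> l" using Cauchy_convergent convergent_def by blast
  have lM: "l \<in> M" using closed_sequentially[OF cl] yM l by blast
  have "(\<lambda>n. (norm (x - y n))\<^sup>2) \<longlonglongrightarrow> (norm (x - l))\<^sup>2"
    by (intro tendsto_intros l)
  moreover have "(\<lambda>n. d + inverse (real (Suc n))) \<longlonglongrightarrow> d + 0"
    by (intro tendsto_intros LIMSEQ_inverse_real_of_nat)
  ultimately have ld: "(norm (x - l))\<^sup>2 \<le> d"
    using y by (intro LIMSEQ_le[of _ _ _ d]) (auto intro: less_imp_le)
  have "inner (x - l) z = 0" if z: "z \<in> M" for z
  proof (rule ccontr)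
    assume nz: "inner (x - l) z \<noteq> 0"
    then have zz: "inner z z \<noteq> 0" by auto
    define t where "t = inner (x - l) z / inner z z"
    have "l + t *\<^sub>R z \<in> M" by (intro subspace_add[OF sub] subspace_scale[OF sub] lM z)
    from order_trans[OF ld lower[OF this]] 
    have "(norm (x - l))\<^sup>2 \<le> (norm (x - (l + t *\<^sub>R z)))\<^sup>2" .
    also have "\<dots> = (norm (x - l))\<^sup>2 - 2 * t * inner (x - l) z + t * (t * inner z z)"
      by (simp add: power2_norm_eq_inner algebra_simps inner_commute)
    also have "t * inner z z = inner (x - l) z" using zz by (simp add: t_def)
    finally have "t * inner (x - l) z \<le> 0" by simp
    moreover have "t * inner (x - l) z = (inner (x - l) z)\<^sup>2 / inner z z"
      by (simp add: t_def power2_eq_square)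
    moreover have "\<dots> > 0" using nz zz by (simp add: divide_pos_pos order_less_le)
    ultimately show False by linarith
  qed
  then show ?thesis using lM by blast
qed

text \<open>The orthogonal projection onto \<open>M\<close>, meaningful when \<open>M\<close> is a closed subspace.\<close>

definition orth_proj :: "'a::real_inner set \<Rightarrow> 'a \<Rightarrow> 'a" where
  "orth_proj M x = (SOME y. y \<in> M \<and> (\<forall>z\<in>M. inner (x - y) z = 0))"

text \<open>Closed linear subspaces of a real Hilbert space.\<close>

locale closed_subspace =
  fixes M :: "'a::{real_inner,banach} set"
  assumes sub: "subspace M" and cl: "closed M"
begin

lemma orth_proj_mem: "orth_proj M x \<in> M"
  and orth_proj_orth: "z \<in> M \<Longrightarrow> inner (x - orth_proj M x) z = 0"
proof -
  have "orth_proj M x \<in> M \<and> (\<forall>z\<in>M. inner (x - orth_proj M x) z = 0)"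
    unfolding orth_proj_def by (rule someI_ex) (use nearest_point_exists[OF sub cl] in blast)
  then show "orth_proj M x \<in> M" "z \<in> M \<Longrightarrow> inner (x - orth_proj M x) z = 0" by auto
qed

lemma orth_proj_unique:
  assumes "y \<in> M" "\<And>z. z \<in> M \<Longrightarrow> inner (x - y) z = 0"
  shows "orth_proj M x = y"
proof -
  have m: "orth_proj M x - y \<in> M" by (intro subspace_diff sub orth_proj_mem assms)
  have "inner (orth_proj M x - y) (orth_proj M x - y) = 
     inner (x - y) (orth_proj M x - y) - inner (x - orth_proj M x) (orth_proj M x - y)"
    by (simp add: inner_diff_left)
  also have "\<dots> = 0" using assms(2)[OF m] orth_proj_orth[OF m] by simp
  finally show ?thesis by simp
qed

lemma orth_proj_id: "x \<in> M \<Longrightarrow> orth_proj M x = x"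
  by (rule orth_proj_unique) auto

lemma orth_proj_inner: "z \<in> M \<Longrightarrow> inner (orth_proj M x) z = inner x z"
  using orth_proj_orth[of z x] by (simp add: inner_diff_left)

lemma orth_proj_add: "orth_proj M (x + y) = orth_proj M x + orth_proj M y"
  by (rule orth_proj_unique) 
     (auto simp: inner_diff_left inner_add_left orth_proj_inner subspace_add[OF sub] orth_proj_mem)

lemma orth_proj_scale: "orth_proj M (c *\<^sub>R x) = c *\<^sub>R orth_proj M x"
  by (rule orth_proj_unique) 
     (auto simp: inner_diff_left orth_proj_inner subspace_scale[OF sub] orth_proj_mem)

lemma linear_orth_proj: "linear (orth_proj M)"
  by (rule linearI) (simp_all add: orth_proj_add orth_proj_scale)

lemma orth_proj_idem: "orth_proj M (orth_proj M x) = orth_proj M x"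
  by (rule orth_proj_id[OF orth_proj_mem])

lemma orth_proj_sym: "inner (orth_proj M x) y = inner x (orth_proj M y)"
  using orth_proj_inner[OF orth_proj_mem, of x y] orth_proj_inner[OF orth_proj_mem, of y x]
  by (simp add: inner_commute)

lemma orth_proj_norm: "(norm (orth_proj M x))\<^sup>2 = inner (orth_proj M x) x"
  using orth_proj_sym[of "orth_proj M x" x] by (simp add: orth_proj_idem power2_norm_eq_inner)

lemma orth_proj_pythagoras: "(norm x)\<^sup>2 = (norm (orth_proj M x))\<^sup>2 + (norm (x - orth_proj M x))\<^sup>2"
proof -
  have "(norm (x - p))\<^sup>2 = (norm x)\<^sup>2 - 2 * inner p x + (norm p)\<^sup>2" for p
    by (simp add: power2_norm_eq_inner algebra_simps inner_commute)
  from this[of "orth_proj M x"] show ?thesis using orth_proj_norm[of x] by simp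
qed

lemma orth_proj_norm_le: "norm (orth_proj M x) \<le> norm x"
proof (rule power2_le_imp_le)
  show "(norm (orth_proj M x))\<^sup>2 \<le> (norm x)\<^sup>2"
    unfolding orth_proj_pythagoras[of x] by simp
qed simp

text \<open>A symmetric operator that leaves \<open>M\<close> invariant commutes with the projection onto \<open>M\<close>.\<close>

lemma orth_proj_commute:
  assumes lin: "linear S" and sym: "\<And>x y. inner (S x) y = inner x (S y)" and inv: "\<And>x. x \<in> M \<Longrightarrow> S x \<in> M"
  shows "orth_proj M (S x) = S (orth_proj M x)"
proof (rule orth_proj_unique)
  fix z assume "z \<in> M"
  then show "inner (S x - S (orth_proj M x)) z = 0"
    using orth_proj_orth[OF inv[of z], of x] by (simp add: sym flip: linear_diff[OF lin])
qed (intro inv orth_proj_mem)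

end

lemma orth_proj_nested:
  assumes "closed_subspace M" "closed_subspace N" "M \<subseteq> N"
  shows "orth_proj M (orth_proj N x) = orth_proj M x" "orth_proj N (orth_proj M x) = orth_proj M x"
proof -
  interpret M: closed_subspace M by fact
  interpret N: closed_subspace N by fact
  show "orth_proj N (orth_proj M x) = orth_proj M x"
    using N.orth_proj_id M.orth_proj_mem assms(3) by blast
  show "orth_proj M (orth_proj N x) = orth_proj M x"
    by (rule M.orth_proj_unique) 
      (use assms(3) in \<open>auto simp: M.orth_proj_mem inner_diff_left M.orth_proj_inner N.orth_proj_inner subset_eq\<close>)
qed

lemma orth_proj_nested_diff:
  assumes "closed_subspace M" "closed_subspace N" "M \<subseteq> N"
  shows "(norm (orth_proj N x - orth_proj M x))\<^sup>2 = (norm (orth_proj N x))\<^sup>2 - (norm (orth_proj M x))\<^sup>2"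
  using closed_subspace.orth_proj_pythagoras[OF assms(1), of "orth_proj N x"]
  by (simp add: orth_proj_nested[OF assms])

section \<open>The modulus of a bounded symmetric operator\<close>

lemma linear_limit:
  fixes Z :: "nat \<Rightarrow> 'a::real_normed_vector \<Rightarrow> 'b::real_normed_vector"
  assumes "\<And>n. linear (Z n)" "\<And>f. (\<lambda>n. Z n f) \<longlonglongrightarrow> Y f"
  shows "linear Y"
proof (rule linearI)
  show "Y (a + b) = Y a + Y b" for a b
    by (rule LIMSEQ_unique[OF assms(2)])
      (use tendsto_add[OF assms(2)[of a] assms(2)[of b]] in \<open>simp add: linear_add[OF assms(1)]\<close>)
  show "Y (r *\<^sub>R b) = r *\<^sub>R Y b" for r b
    by (rule LIMSEQ_unique[OF assms(2)])
      (use tendsto_scaleR[OF tendsto_const assms(2)[of b]] in \<open>simp add: linear_cmul[OF assms(1)]\<close>)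
qed

text \<open>
  The square root of \<open>1 - X\<close> for a symmetric contraction \<open>X\<close>. It is \<open>1 - Y\<close> where \<open>Y\<close> is the limit of
  \<open>Z\<^sub>0 = 0\<close>, \<open>Z\<^sub>n\<^sub>+\<^sub>1 = (X + Z\<^sub>n\<^sup>2) / 2\<close>. The same iteration with \<open>X = 1\<close> gives real numbers \<open>z\<^sub>n\<close> that
  increase and never exceed \<open>1\<close>, and \<open>z\<close> dominates \<open>Z\<close>: \<open>\<parallel>Z\<^sub>n\<^sub>+\<^sub>1 - Z\<^sub>n\<parallel> \<le> z\<^sub>n\<^sub>+\<^sub>1 - z\<^sub>n\<close>. So \<open>Z\<close> is a Cauchy
  sequence.
\<close>

lemma symmetric_sqrt_exists:
  fixes X :: "'a::{real_inner,banach} \<Rightarrow> 'a"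
  assumes lin: "linear X" and sym: "\<And>x y. inner (X x) y = inner x (X y)" and contr: "\<And>x. norm (X x) \<le> norm x"
  obtains C where "linear C" "\<And>x y. inner (C x) y = inner x (C y)" "\<And>x. 0 \<le> inner (C x) x"
    "\<And>x. C (C x) = x - X x" 
    "\<And>S x. linear S \<Longrightarrow> (\<And>x. norm (S x) \<le> norm x) \<Longrightarrow> (\<And>x. S (X x) = X (S x)) \<Longrightarrow> S (C x) = C (S x)"
proof -
  define Z where "Z = rec_nat (\<lambda>x. 0::'a) (\<lambda>_ Y x. (1/2) *\<^sub>R (X x + Y (Y x)))"
  define z where "z = rec_nat (0::real) (\<lambda>_ y. (1 + y * y) / 2)"
  have Z0: "Z 0 x = 0" for x by (simp add: Z_def)
  have ZS: "Z (Suc n) x = (1/2) *\<^sub>R (X x + Z n (Z n x))" for n x by (simp add: Z_def)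
  have z0: "z 0 = 0" by (simp add: z_def)
  have zS: "z (Suc n) = (1 + z n * z n) / 2" for n by (simp add: z_def)
  have linZ: "linear (Z n)" for n
  proof (induction n)
    case 0 show ?case by (rule linearI) (simp_all add: Z0)
  next
    case (Suc n)
    show ?case
      by (rule linearI) (simp_all add: ZS linear_add[OF lin] linear_add[OF Suc] linear_cmul[OF lin] 
          linear_cmul[OF Suc] algebra_simps)
  qed
  have symZ: "inner (Z n x) y = inner x (Z n y)" for n x y
  proof (induction n arbitrary: x y)
    case (Suc n) then show ?case by (simp add: ZS inner_add_left inner_add_right sym)
  qed (simp add: Z0)
  have z_bounds: "0 \<le> z n \<and> z n \<le> 1" for n
  proof (induction n)
    case (Suc n) then show ?case using mult_le_one[of "z n" "z n"] by (simp add: zS)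
  qed (simp add: z0)
  have normZ: "norm (Z n x) \<le> z n * norm x" for n x
  proof (induction n arbitrary: x)
    case (Suc n)
    have "norm (X x + Z n (Z n x)) \<le> norm x + z n * (z n * norm x)"
      using norm_triangle_ineq[of "X x" "Z n (Z n x)"] contr[of x] Suc[of "Z n x"] 
        mult_left_mono[OF Suc[of x], of "z n"] z_bounds[of n] by linarith
    moreover have "norm (Z (Suc n) x) = norm (X x + Z n (Z n x)) / 2"
      by (simp add: ZS del: scaleR_add_right)
    ultimately show ?case by (simp add: zS algebra_simps)
  qed (simp add: Z0 z0)
  have comm_gen: "S (Z n x) = Z n (S x)" if "linear S" "\<And>x. S (X x) = X (S x)" for S n x
  proof (induction n arbitrary: x)
    case (Suc n) then show ?case by (simp add: ZS linear_cmul[OF that(1)] linear_add[OF that(1)] that(2))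
  qed (simp add: Z0 linear_0[OF that(1)])
  have commX: "X (Z n x) = Z n (X x)" for n x by (rule comm_gen[OF lin]) simp
  have commZ: "Z m (Z n x) = Z n (Z m x)" for m n x
    by (rule comm_gen[OF linZ]) (simp add: commX)
  have diffZ: "norm (Z (Suc n) x - Z n x) \<le> (z (Suc n) - z n) * norm x" for n x
  proof (induction n arbitrary: x)
    case 0 show ?case using contr[of x] by (simp add: ZS Z0 zS z0)
  next
    case (Suc n)
    let ?w = "Z (Suc n) x - Z n x"
    have eq: "Z (Suc (Suc n)) x - Z (Suc n) x = (1/2) *\<^sub>R (Z (Suc n) ?w + Z n ?w)"
      unfolding ZS[of "Suc n" x] 
      by (subst (2) ZS) (simp add: linear_diff[OF linZ] commZ[of n "Suc n"] algebra_simps)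
    have "norm (Z (Suc n) ?w + Z n ?w) \<le> (z (Suc n) + z n) * norm ?w"
      using norm_triangle_ineq[of "Z (Suc n) ?w" "Z n ?w"] normZ[of "Suc n" ?w] normZ[of n ?w]
      by (simp add: algebra_simps)
    also have "\<dots> \<le> (z (Suc n) + z n) * ((z (Suc n) - z n) * norm x)"
      using z_bounds by (intro mult_left_mono Suc) (simp add: add_nonneg_nonneg)
    also have "\<dots> = 2 * ((z (Suc (Suc n)) - z (Suc n)) * norm x)"
      unfolding zS[of "Suc n"] by (subst (5) zS) (simp add: algebra_simps)
    finally show ?case unfolding eq by simp
  qed
  have z_mono: "z n \<le> z (Suc n)" for n
  proof -
    have "0 \<le> (1 - z n)\<^sup>2" by simp
    then show ?thesis unfolding zS by (simp add: power2_eq_square algebra_simps)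
  qed
  have "incseq z" using z_mono by (rule incseq_SucI)
  then have "convergent z"
    using z_bounds by (intro Bseq_monoseq_convergent) (auto intro!: BseqI'[of z 1] simp: monoseq_iff)
  then have sum_z: "summable (\<lambda>n. (z (Suc n) - z n) * norm x)" for x :: 'a
    by (intro summable_mult2) (use telescope_summable in \<open>auto simp: convergent_def\<close>)
  have convZ: "convergent (\<lambda>n. Z n x)" for x
  proof -
    have "summable (\<lambda>n. Z (Suc n) x - Z n x)"
      by (rule summable_comparison_test'[OF sum_z, of 0]) (use diffZ in auto)
    then have "convergent (\<lambda>n. \<Sum>k<n. Z (Suc k) x - Z k x)" by (simp add: summable_iff_convergent)
    moreover have "(\<Sum>k<n. Z (Suc k) x - Z k x) = Z n x" for n
      by (subst sum_lessThan_telescope) (simp add: Z0)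
    ultimately show ?thesis by simp
  qed
  define Y where "Y x = lim (\<lambda>n. Z n x)" for x
  have ZY: "(\<lambda>n. Z n x) \<longlonglongrightarrow> Y x" for x using convZ convergent_LIMSEQ_iff Y_def by metis
  have linY: "linear Y" by (rule linear_limit[OF linZ ZY])
  have normZ1: "norm (Z n x) \<le> norm x" for n x
    using normZ[of n x] z_bounds[of n] mult_right_mono[of "z n" 1 "norm x"] by simp
  have normY: "norm (Y x) \<le> norm x" for x
    by (rule LIMSEQ_le_const2[OF tendsto_norm[OF ZY]]) (use normZ1 in auto)
  have symY: "inner (Y x) y = inner x (Y y)" for x y
    by (rule LIMSEQ_unique[OF tendsto_inner[OF ZY tendsto_const]]) 
      (use tendsto_inner[OF tendsto_const ZY] in \<open>simp add: symZ\<close>)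
  have ZZ: "(\<lambda>n. Z n (Z n x)) \<longlonglongrightarrow> Y (Y x)" for x
  proof -
    have "(\<lambda>n. Z n (Z n x - Y x)) \<longlonglongrightarrow> 0"
    proof (rule tendsto_norm_zero_cancel, rule tendsto_sandwich[OF _ _ tendsto_const])
      show "(\<lambda>n. norm (Z n x - Y x)) \<longlonglongrightarrow> 0"
        using tendsto_norm[OF tendsto_diff[OF ZY[of x] tendsto_const[of "Y x"]]] by simp
    qed (use normZ1 in auto)
    from tendsto_add[OF this ZY[of "Y x"]] show ?thesis by (simp add: linear_diff[OF linZ])
  qed
  have fixY: "Y x = (1/2) *\<^sub>R (X x + Y (Y x))" for x
    by (rule LIMSEQ_unique[OF LIMSEQ_Suc[OF ZY]]) (unfold ZS, intro tendsto_intros ZZ)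
  show ?thesis
  proof
    show "linear (\<lambda>x. x - Y x)" by (intro linear_compose_sub linY linear_ident)
    show "inner (x - Y x) y = inner x (y - Y y)" for x y
      by (simp add: inner_diff_left inner_diff_right symY)
    show "0 \<le> inner (x - Y x) x" for x
    proof -
      have "inner (Y x) x \<le> norm x * norm x"
        using norm_cauchy_schwarz[of "Y x" x] mult_right_mono[OF normY[of x], of "norm x"] by simp
      then show ?thesis by (simp add: inner_diff_left power2_norm_eq_inner flip: power2_eq_square)
    qed
    show "x - Y x - Y (x - Y x) = x - X x" for x
    proof -
      have "2 *\<^sub>R Y x = X x + Y (Y x)" by (subst fixY) simp
      then show ?thesis by (simp add: linear_diff[OF linY] scaleR_2 algebra_simps)
    qed
    show "S (x - Y x) = S x - Y (S x)" 
      if S: "linear S" "\<And>x. norm (S x) \<le> norm x" "\<And>x. S (X x) = X (S x)" for S x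
    proof -
      have "(\<lambda>n. S (Z n x - Y x)) \<longlonglongrightarrow> 0"
      proof (rule tendsto_norm_zero_cancel, rule tendsto_sandwich[OF _ _ tendsto_const])
        show "(\<lambda>n. norm (Z n x - Y x)) \<longlonglongrightarrow> 0"
          using tendsto_norm[OF tendsto_diff[OF ZY[of x] tendsto_const[of "Y x"]]] by simp
      qed (use S in auto)
      from tendsto_add[OF this tendsto_const[of "S (Y x)"]] 
      have "(\<lambda>n. Z n (S x)) \<longlonglongrightarrow> S (Y x)" by (simp add: linear_diff[OF S(1)] comm_gen[OF S(1,3)])
      then have "Y (S x) = S (Y x)" by (rule LIMSEQ_unique[OF ZY])
      then show ?thesis by (simp add: linear_diff[OF S(1)])
    qed
  qed
qed

section \<open>Spectral subspaces of a positive contraction\<close>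

text \<open>
  If \<open>0 \<le> S \<le> c\<close> as a quadratic form on an invariant subspace \<open>K\<close>, then \<open>S\<^sup>2 \<le> c S\<close> on \<open>K\<close>. For
  \<open>c > 0\<close> this comes from positivity at \<open>u - S u / c\<close>.
\<close>

lemma psd_norm_le:
  fixes S :: "'a::real_inner \<Rightarrow> 'a"
  assumes lin: "linear S" and sym: "\<And>x y. inner (S x) y = inner x (S y)"
    and K: "subspace K" "\<And>x. x \<in> K \<Longrightarrow> S x \<in> K"
    and pos: "\<And>x. x \<in> K \<Longrightarrow> 0 \<le> inner (S x) x"
    and ub: "\<And>x. x \<in> K \<Longrightarrow> inner (S x) x \<le> c * (norm x)\<^sup>2"
    and c: "0 \<le> c" and u: "u \<in> K"
  shows "(norm (S u))\<^sup>2 \<le> c * inner (S u) u"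
proof -
  have key: "0 \<le> inner (S u) u - 2 * t * (norm (S u))\<^sup>2 + t * (t * c * (norm (S u))\<^sup>2)" for t
  proof -
    have "u - t *\<^sub>R S u \<in> K" using u K by (intro subspace_diff subspace_scale) auto
    from pos[OF this] have "0 \<le> inner (S (u - t *\<^sub>R S u)) (u - t *\<^sub>R S u)" .
    also have "\<dots> = inner (S u) u - t * inner (S u) (S u) - t * inner (S (S u)) u + t * (t * inner (S (S u)) (S u))"
      by (simp add: linear_diff[OF lin] linear_cmul[OF lin] inner_diff_left inner_diff_right algebra_simps)
    also have "inner (S (S u)) u = inner (S u) (S u)" by (rule sym)
    also have "t * (t * inner (S (S u)) (S u)) \<le> t * (t * (c * (norm (S u))\<^sup>2))"
    proof -
      have "t * t * inner (S (S u)) (S u) \<le> t * t * (c * (norm (S u))\<^sup>2)"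
        by (intro mult_left_mono ub K(2) u) simp
      then show ?thesis by (simp only: mult.assoc)
    qed
    finally show ?thesis by (simp add: power2_norm_eq_inner algebra_simps)
  qed
  show ?thesis
  proof (cases "c = 0")
    case True
    then have "inner (S u) u = 0" using pos[OF u] ub[OF u] by simp
    then show ?thesis using key[of 1] True by simp
  next
    case False
    then show ?thesis using key[of "1 / c"] c by (simp add: field_simps)
  qed
qed

text \<open>
  Symmetric operators with \<open>0 \<le> R \<le> 1\<close>, which is expressed by the single inequality \<open>R\<^sup>2 \<le> R\<close>.
\<close>

locale positive_contraction =
  fixes R :: "'a::{real_inner,banach} \<Rightarrow> 'a"
  assumes lin: "linear R"
    and sym: "inner (R x) y = inner x (R y)"
    and norm_sq_le: "(norm (R x))\<^sup>2 \<le> inner (R x) x"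
begin

lemma nonneg: "0 \<le> inner (R x) x"
  using norm_sq_le[of x] by (meson order_trans zero_le_power2)

lemma norm_le: "norm (R x) \<le> norm x"
proof (cases "R x = 0")
  case False
  have "norm (R x) * norm (R x) \<le> norm (R x) * norm x"
    using norm_sq_le[of x] norm_cauchy_schwarz[of "R x" x] by (simp add: power2_eq_square)
  then show ?thesis using False by simp
qed simp

lemma le_norm_sq: "inner (R x) x \<le> (norm x)\<^sup>2"
  using norm_cauchy_schwarz[of "R x" x] mult_right_mono[OF norm_le[of x], of "norm x"]
  by (simp add: power2_eq_square)

lemma linear_pow: "linear (R ^^ n)"
proof (induction n)
  case 0 show ?case by (simp add: linear_id[unfolded id_def] id_def)
next
  case (Suc n) show ?case unfolding funpow.simps(2) by (rule linear_compose[OF Suc lin])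
qed

lemma norm_pow_le: "norm ((R ^^ n) x) \<le> norm x"
  by (induction n) (auto intro: order_trans[OF norm_le])

lemma commute_pow: "(\<And>x. S (R x) = R (S x)) \<Longrightarrow> S ((R ^^ n) x) = (R ^^ n) (S x)"
  by (induction n) auto

text \<open>
  The range of the spectral projector of \<open>R\<close> for the interval \<open>[0,r]\<close>, described by the growth of
  the powers of \<open>R\<close>.
\<close>

definition low :: "real \<Rightarrow> 'a set" where
  "low r = {f. \<exists>C. \<forall>n. norm ((R ^^ n) f) \<le> C * r ^ n}"

text \<open>
  The sequence \<open>\<parallel>R\<^sup>n f\<parallel>\<close> is log-convex: its ratios increase, so none of them can exceed \<open>r\<close> if
  it is \<open>O(r\<^sup>n)\<close>. This removes the constant from the definition of \<open>low\<close>.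
\<close>

lemma low_norm_le:
  assumes r: "0 \<le> r" and f: "f \<in> low r"
  shows "norm (R f) \<le> r * norm f"
proof (rule ccontr)
  assume "\<not> norm (R f) \<le> r * norm f"
  then have gt: "r * norm f < norm (R f)" by simp
  define a where "a n = norm ((R ^^ n) f)" for n
  obtain C where C: "\<And>n. a n \<le> C * r ^ n" using f by (auto simp: low_def a_def)
  have f0: "0 < norm f" using gt linear_0[OF lin] by auto
  define q where "q = norm (R f) / norm f"
  have qr: "r < q" using gt f0 by (simp add: q_def pos_less_divide_eq)
  have lc: "(a (Suc n))\<^sup>2 \<le> a n * a (Suc (Suc n))" for n
  proof -
    have "(a (Suc n))\<^sup>2 = inner ((R ^^ n) f) (R (R ((R ^^ n) f)))"
      by (simp add: a_def power2_norm_eq_inner sym)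
    also have "\<dots> \<le> a n * a (Suc (Suc n))" using norm_cauchy_schwarz by (simp add: a_def)
    finally show ?thesis .
  qed
  have step: "0 < a n \<and> q * a n \<le> a (Suc n)" for n
  proof (induction n)
    case 0 show ?case using f0 by (simp add: a_def q_def)
  next
    case (Suc n)
    have "0 < q * a n" using Suc qr r by simp
    then have pos: "0 < a (Suc n)" using Suc by linarith
    have "(q * a (Suc n)) * a n \<le> a (Suc n) * a (Suc n)"
      using mult_right_mono[of "q * a n" "a (Suc n)" "a (Suc n)"] Suc pos by (simp add: algebra_simps)
    also have "\<dots> \<le> a (Suc (Suc n)) * a n" using lc[of n] by (simp add: power2_eq_square mult.commute)
    finally show ?case using pos Suc by simp
  qed
  have grow: "q ^ n * norm f \<le> a n" for n
  proof (induction n)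
    case (Suc n)
    have "q ^ Suc n * norm f \<le> q * a n"
      using mult_left_mono[OF Suc, of q] qr r by (simp add: algebra_simps)
    then show ?case using step[of n] by linarith
  qed (simp add: a_def)
  show False
  proof (cases "r = 0")
    case True
    then show False using C[of 1] step[of 1] by simp
  next
    case False
    then have r0: "0 < r" using r by simp
    obtain n where n: "C / norm f < (q / r) ^ n"
      using real_arch_pow[of "q / r"] qr r0 by auto
    then have "C * r ^ n < q ^ n * norm f"
      using f0 r0 by (simp add: power_divide field_simps)
    then show False using C[of n] grow[of n] by linarith
  qed
qed

lemma low_invariant:
  assumes S: "linear S" "\<And>x. norm (S x) \<le> K * norm x" "\<And>x. S (R x) = R (S x)" and f: "f \<in> low r" and K: "0 \<le> K"
  shows "S f \<in> low r"
proof -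
  obtain C where C: "\<And>n. norm ((R ^^ n) f) \<le> C * r ^ n" using f by (auto simp: low_def)
  have "norm ((R ^^ n) (S f)) \<le> (K * C) * r ^ n" for n
    using S(2)[of "(R ^^ n) f"] mult_left_mono[OF C[of n] K] by (simp add: commute_pow[of S, OF S(3)] mult.assoc)
  then show ?thesis by (auto simp: low_def)
qed

lemma low_R: "f \<in> low r \<Longrightarrow> R f \<in> low r"
  by (rule low_invariant[OF lin, of 1]) (auto simp: norm_le)

lemma low_norm_pow:
  assumes r: "0 \<le> r" and f: "f \<in> low r"
  shows "norm ((R ^^ n) f) \<le> r ^ n * norm f"
proof (induction n)
  case (Suc n)
  have "(R ^^ n) f \<in> low r" by (induction n) (auto simp: f low_R)
  from low_norm_le[OF r this] show ?case using mult_left_mono[OF Suc r] by (simp add: mult.assoc)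
qed simp

lemma lowI: "(\<And>n. norm ((R ^^ n) f) \<le> r ^ n * norm f) \<Longrightarrow> f \<in> low r"
  unfolding low_def by (auto simp: mult.commute)

lemma low_mono: "0 \<le> r \<Longrightarrow> r \<le> s \<Longrightarrow> low r \<subseteq> low s"
proof (rule subsetI, rule lowI)
  fix f n assume "0 \<le> r" "r \<le> s" "f \<in> low r"
  then show "norm ((R ^^ n) f) \<le> s ^ n * norm f"
    by (intro order_trans[OF low_norm_pow] mult_right_mono power_mono) auto
qed

lemma low_Inter:
  assumes "\<And>k. 0 \<le> s k" "s \<longlonglongrightarrow> r" "\<And>k. f \<in> low (s k)"
  shows "f \<in> low r"
proof (rule lowI)
  fix n
  show "norm ((R ^^ n) f) \<le> r ^ n * norm f"
    by (rule LIMSEQ_le_const[of "\<lambda>k. s k ^ n * norm f"])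
      (use assms low_norm_pow in \<open>auto intro!: tendsto_intros\<close>)
qed

lemma subspace_low: "subspace (low r)"
proof (rule subspaceI)
  show "0 \<in> low r" by (auto simp: low_def linear_0[OF linear_pow] intro!: exI[of _ 0])
  show "x + y \<in> low r" if x: "x \<in> low r" and y: "y \<in> low r" for x y
  proof -
    obtain C where C: "\<And>n. norm ((R ^^ n) x) \<le> C * r ^ n" using x by (auto simp: low_def)
    obtain D where D: "\<And>n. norm ((R ^^ n) y) \<le> D * r ^ n" using y by (auto simp: low_def)
    have "norm ((R ^^ n) (x + y)) \<le> (C + D) * r ^ n" for n
      unfolding linear_add[OF linear_pow] distrib_right
      by (rule order_trans[OF norm_triangle_ineq add_mono[OF C D]])
    then show ?thesis by (auto simp: low_def)
  qed
  show "c *\<^sub>R x \<in> low r" if "x \<in> low r" for c x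
    using that by (intro low_invariant[of "\<lambda>x. c *\<^sub>R x" "\<bar>c\<bar>"]) (auto simp: linear_cmul[OF lin] linear_scale_self)
qed

lemma closed_low:
  assumes r: "0 \<le> r"
  shows "closed (low r)"
  unfolding closed_sequential_limits
proof (intro allI impI)
  fix x l assume "(\<forall>n. x n \<in> low r) \<and> x \<longlonglongrightarrow> l"
  then have x: "\<And>n. x n \<in> low r" and l: "x \<longlonglongrightarrow> l" by auto
  have bl: "bounded_linear (R ^^ n)" for n
    by (rule bounded_linear_intro[of _ 1]) 
      (auto simp: linear_add[OF linear_pow] linear_cmul[OF linear_pow] norm_pow_le)
  show "l \<in> low r"
  proof (rule lowI)
    fix n show "norm ((R ^^ n) l) \<le> r ^ n * norm l"
      by (rule LIMSEQ_le[OF tendsto_norm[OF bounded_linear.tendsto[OF bl l]] 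
            tendsto_mult_left[OF tendsto_norm[OF l]]]) (use low_norm_pow[OF r x] in auto)
  qed
qed

lemma closed_subspace_low: "0 \<le> r \<Longrightarrow> closed_subspace (low r)"
  by unfold_locales (auto simp: subspace_low closed_low)

text \<open>The orthogonal complement of \<open>low r\<close>.\<close>

definition high :: "real \<Rightarrow> 'a set" where
  "high r = {f. \<forall>z\<in>low r. inner f z = 0}"

lemma closed_subspace_high: "closed_subspace (high r)"
proof
  show "subspace (high r)"
    by (rule subspaceI) (auto simp: high_def inner_add_left)
  show "closed (high r)"
  proof -
    have "high r = (\<Inter>z\<in>low r. {f. inner f z = 0})" by (auto simp: high_def)
    moreover have "closed {f. inner f z = 0}" for z :: 'a
      by (intro closed_Collect_eq continuous_intros)
    ultimately show ?thesis by auto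
  qed
qed

lemma high_R: "f \<in> high r \<Longrightarrow> R f \<in> high r"
  by (auto simp: high_def sym low_R)

text \<open>
  On the orthogonal complement of \<open>low r\<close> one has \<open>0 \<le> R - r \<le> 1 - r\<close>, in a quadratic form. Put
  \<open>A = R - r\<close> and let \<open>C = \<bar>A\<bar>\<close>. On \<open>N = ker (A + C)\<close> the operator \<open>A\<close> is \<open>- C \<le> 0\<close>, hence
  \<open>N \<subseteq> low r\<close>, and on the complement of \<open>N\<close> it is \<open>C \<ge> 0\<close> because \<open>(A + C) (A - C) = 0\<close>.
\<close>

lemma high_ineq:
  assumes r: "0 \<le> r" "r \<le> 1" and f: "f \<in> high r"
  shows "(norm (R f - r *\<^sub>R f))\<^sup>2 \<le> (1 - r) * (inner (R f) f - r * (norm f)\<^sup>2)"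
proof -
  define A where "A x = R x - r *\<^sub>R x" for x
  have linA: "linear A" unfolding A_def 
    by (intro linear_compose_sub lin linear_scale_self)
  have symA: "inner (A x) y = inner x (A y)" for x y
    by (simp add: A_def inner_diff_left inner_diff_right sym)
  have normA: "norm (A x) \<le> norm x" for x
  proof (rule power2_le_imp_le)
    have "(norm (A x))\<^sup>2 = (norm (R x))\<^sup>2 - 2 * r * inner (R x) x + r\<^sup>2 * (norm x)\<^sup>2"
      unfolding A_def power2_norm_eq_inner inner_diff_left inner_diff_right
      by (simp add: inner_commute[of x "R x"] algebra_simps power2_eq_square)
    also have "\<dots> \<le> (norm x)\<^sup>2 - (1 - r) * ((norm x)\<^sup>2 - inner (R x) x) - r * inner (R x) x
       - r * (1 - r) * (norm x)\<^sup>2"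
      using norm_sq_le[of x] by (simp add: algebra_simps power2_eq_square)
    also have "\<dots> \<le> (norm x)\<^sup>2"
    proof -
      have "0 \<le> (1 - r) * ((norm x)\<^sup>2 - inner (R x) x)" "0 \<le> r * inner (R x) x"
         "0 \<le> r * (1 - r) * (norm x)\<^sup>2" using r nonneg[of x] le_norm_sq[of x] by auto
      then show ?thesis by linarith
    qed
    finally show "(norm (A x))\<^sup>2 \<le> (norm x)\<^sup>2" .
  qed simp
  have RA: "R (A x) = A (R x)" for x by (simp add: A_def linear_diff[OF lin] linear_cmul[OF lin])
  define X where "X x = x - A (A x)" for x
  have linX: "linear X" unfolding X_def
    by (intro linear_compose_sub linear_ident linear_compose[OF linA linA, unfolded o_def])
  have symX: "inner (X x) y = inner x (X y)" for x y
    by (simp add: X_def inner_diff_left inner_diff_right symA)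
  have normX: "norm (X x) \<le> norm x" for x
  proof (rule power2_le_imp_le)
    have "(norm (X x))\<^sup>2 = (norm x)\<^sup>2 - 2 * inner (A (A x)) x + (norm (A (A x)))\<^sup>2"
      by (simp add: X_def power2_norm_eq_inner inner_diff_left inner_diff_right inner_commute)
    moreover have "inner (A (A x)) x = (norm (A x))\<^sup>2" by (simp add: symA power2_norm_eq_inner)
    moreover have "(norm (A (A x)))\<^sup>2 \<le> (norm (A x))\<^sup>2" by (simp add: normA power_mono)
    ultimately show "(norm (X x))\<^sup>2 \<le> (norm x)\<^sup>2" using zero_le_power2[of "norm (A x)"] by linarith
  qed simp
  obtain C where linC: "linear C" and symC: "\<And>x y. inner (C x) y = inner x (C y)"
    and posC: "\<And>x. 0 \<le> inner (C x) x" 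
    and CX: "\<And>x. C (C x) = x - X x"
    and commC: "\<And>S x. linear S \<Longrightarrow> (\<And>x. norm (S x) \<le> norm x) \<Longrightarrow> (\<And>x. S (X x) = X (S x)) \<Longrightarrow> S (C x) = C (S x)"
    by (rule symmetric_sqrt_exists[OF linX symX normX]) blast
  have CC: "C (C x) = A (A x)" for x unfolding CX by (simp add: X_def)
  have RC: "R (C x) = C (R x)" for x
    by (rule commC[OF lin norm_le]) (simp add: X_def linear_diff[OF lin] RA)
  have AC: "A (C x) = C (A x)" for x
    by (rule commC[OF linA normA]) (simp add: X_def linear_diff[OF linA])
  define N where "N = {x. A x + C x = 0}"
  have subN: "subspace N"
    unfolding N_def by (rule linear_subspace_kernel[of "\<lambda>x. A x + C x"]) (intro linear_compose_add linA linC)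
  have N_R: "R x \<in> N" if "x \<in> N" for x
  proof -
    have "A (R x) + C (R x) = R (A x + C x)" by (simp add: linear_add[OF lin] RA RC)
    then show ?thesis using that by (simp add: N_def linear_0[OF lin])
  qed
  have N_A: "A x \<in> N" if "x \<in> N" for x
    unfolding A_def using that by (intro subspace_diff subN N_R subspace_scale)
  have N_step: "norm (R x) \<le> r * norm x" if x: "x \<in> N" for x
  proof (rule power2_le_imp_le)
    have ub: "inner (R y) y \<le> r * (norm y)\<^sup>2" if "y \<in> N" for y
    proof -
      have "inner (A y) y = - inner (C y) y"
        using that by (simp add: N_def add_eq_0_iff)
      then show ?thesis using posC[of y] 
        by (simp add: A_def inner_diff_left power2_norm_eq_inner)
    qed
    have "(norm (R x))\<^sup>2 \<le> r * inner (R x) x"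
      by (rule psd_norm_le[OF lin sym subN N_R nonneg ub r(1) x])
    also have "\<dots> \<le> r * (r * (norm x)\<^sup>2)" by (intro mult_left_mono ub x r)
    finally show "(norm (R x))\<^sup>2 \<le> (r * norm x)\<^sup>2" by (simp add: power_mult_distrib power2_eq_square mult_ac)
  qed (use r in simp)
  have N_low: "x \<in> low r" if x: "x \<in> N" for x
  proof (rule lowI)
    fix n
    have "(R ^^ n) x \<in> N \<and> norm ((R ^^ n) x) \<le> r ^ n * norm x"
    proof (induction n)
      case (Suc n)
      have "norm (R ((R ^^ n) x)) \<le> r * norm ((R ^^ n) x)" using Suc N_step by blast
      also have "\<dots> \<le> r * (r ^ n * norm x)" using Suc r by (intro mult_left_mono) auto
      finally show ?case using Suc N_R by simp
    qed (simp add: x)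
    then show "norm ((R ^^ n) x) \<le> r ^ n * norm x" by simp
  qed
  have high_A: "A g = C g" if g: "g \<in> high r" for g
  proof -
    let ?w = "A g - C g"
    have w: "?w \<in> N" by (simp add: N_def linear_diff[OF linA] linear_diff[OF linC] AC CC)
    have "C ?w = - A ?w" using w by (simp add: N_def add_eq_0_iff)
    then have "inner ?w ?w = inner g (A ?w + A ?w)"
      by (subst inner_diff_left) (simp add: symA symC inner_add_right)
    also have "\<dots> = 0"
      using g N_low[OF N_A[OF w]] by (simp add: high_def inner_add_right)
    finally show ?thesis by simp
  qed
  have "(norm (A f))\<^sup>2 \<le> (1 - r) * inner (A f) f"
  proof (rule psd_norm_le[OF linA symA, of "high r"])
    show sub: "subspace (high r)" using closed_subspace_high closed_subspace.sub by blast
    show "A x \<in> high r" if "x \<in> high r" for x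
      unfolding A_def using that by (intro subspace_diff sub high_R subspace_scale)
    show "0 \<le> inner (A x) x" if "x \<in> high r" for x using posC[of x] high_A[OF that] by simp
    show "inner (A x) x \<le> (1 - r) * (norm x)\<^sup>2" for x
      using le_norm_sq[of x] by (simp add: A_def inner_diff_left power2_norm_eq_inner algebra_simps)
  qed (use r f in auto)
  then show ?thesis by (simp add: A_def inner_diff_left power2_norm_eq_inner)
qed

text \<open>
  The same inequality, read as \<open>(1 - R) (R - r) \<ge> 0\<close>. For \<open>R = H (1 + H)\<^sup>-\<^sup>1\<close> and \<open>r = a / (1 + a)\<close> it
  says that \<open>H \<ge> a\<close>.
\<close>

lemma high_lower_bound:
  assumes r: "0 \<le> r" "r \<le> 1" and g: "g \<in> high r"
  shows "r * (norm (g - R g))\<^sup>2 \<le> (1 - r) * inner (R g) (g - R g)"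
  using high_ineq[OF assms]
  by (simp add: power2_norm_eq_inner inner_diff_left inner_diff_right inner_commute algebra_simps)

text \<open>The Neumann series inverts \<open>1 - R\<close> on \<open>low r\<close>.\<close>

lemma low_inverse:
  assumes r: "0 \<le> r" "r < 1" and f: "f \<in> low r"
  obtains g where "g - R g = f" "(1 - r) * norm (R g) \<le> r * norm f"
proof -
  have summ: "summable (\<lambda>n. (R ^^ n) f)"
    by (rule summable_comparison_test'[of "\<lambda>n. r ^ n * norm f" 0])
      (use r low_norm_pow[OF r(1) f] in \<open>auto intro!: summable_mult2 summable_geometric\<close>)
  define g where "g = (\<Sum>n. (R ^^ n) f)"
  have pow: "(R ^^ n) f \<in> low r" for n by (induction n) (auto simp: f low_R)
  have g_low: "g \<in> low r"
  proof (rule closed_sequentially[OF closed_low[OF r(1)]])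
    show "(\<lambda>n. \<Sum>k<n. (R ^^ k) f) \<longlonglongrightarrow> g" using summable_LIMSEQ[OF summ] by (simp add: g_def)
    show "(\<Sum>k<n. (R ^^ k) f) \<in> low r" for n by (intro subspace_sum subspace_low pow)
  qed
  have bl: "bounded_linear R"
    by (rule bounded_linear_intro[of _ 1]) (auto simp: linear_add[OF lin] linear_cmul[OF lin] norm_le)
  have "R g = (\<Sum>n. (R ^^ Suc n) f)"
    unfolding g_def by (simp add: bounded_linear.suminf[OF bl summ])
  also have "\<dots> = g - f" using suminf_split_head[OF summ] by (simp add: g_def)
  finally have gR: "g - R g = f" by simp
  have "norm g \<le> norm f + norm (R g)" using norm_triangle_ineq[of f "R g"] gR by (auto simp: algebra_simps)
  from mult_left_mono[OF this r(1)] have "(1 - r) * norm (R g) \<le> r * norm f" 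
    using low_norm_le[OF r(1) g_low] by (simp add: algebra_simps)
  then show ?thesis using that gR by blast
qed

end

section \<open>Complex Hilbert spaces\<close>

text \<open>
  The norm and the real inner product of a complex Hilbert space make it a real Hilbert space, so the
  preceding results apply to it.
\<close>

instance complex_hilbert \<subseteq> banach ..

lemma Re_cinner: "Re (cinner x y) = inner x y"
  by (simp add: inner_eq_Re_cinner)

lemma cinner_add_right: "cinner x (y + z) = cinner x y + cinner x z"
  by (metis cinner_add_left cinner_commute complex_cnj_add)

lemma cinner_scaleC_right: "cinner x (c *\<^sub>C y) = c * cinner x y"
  by (metis cinner_scaleC_left cinner_commute complex_cnj_mult complex_cnj_cnj)

lemma cinner_diff_right: "cinner x (y - z) = cinner x y - cinner x z"
  using cinner_add_right[of x "y - z" z] by simp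

lemma inner_scaleC_left: "inner (c *\<^sub>C x) y = inner x (cnj c *\<^sub>C y)"
  by (simp add: cinner_scaleC_left cinner_scaleC_right flip: Re_cinner)

lemma Im_cinner: "Im (cinner x y) = inner (\<i> *\<^sub>C x) y"
  by (simp add: cinner_scaleC_left flip: Re_cinner)

lemma cinner_same: "cinner x x = complex_of_real ((norm x)\<^sup>2)"
proof (rule complex_eqI)
  have "Im (cinner x x) = - Im (cinner x x)" by (metis cinner_commute cnj.simps(2))
  then show "Im (cinner x x) = Im (complex_of_real ((norm x)\<^sup>2))" by simp
qed (simp add: Re_cinner power2_norm_eq_inner)

lemma norm_scaleC: "norm (c *\<^sub>C x) = cmod c * norm (x :: 'a::complex_hilbert)"
proof -
  have "complex_of_real ((norm (c *\<^sub>C x))\<^sup>2) = cnj c * (c * cinner x x)"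
    unfolding cinner_same[symmetric] cinner_scaleC_left cinner_scaleC_right by (simp only: mult.left_commute)
  also have "\<dots> = complex_of_real ((cmod c)\<^sup>2) * cinner x x"
    by (simp add: complex_norm_square mult_ac flip: of_real_power)
  also have "\<dots> = complex_of_real ((cmod c * norm x)\<^sup>2)"
    by (simp add: cinner_same power_mult_distrib)
  finally have "(norm (c *\<^sub>C x))\<^sup>2 = (cmod c * norm x)\<^sup>2" by (simp only: of_real_eq_iff)
  then show ?thesis by (simp add: power2_eq_iff_nonneg)
qed

lemma scaleC_diff_right: "c *\<^sub>C (x - y) = c *\<^sub>C x - c *\<^sub>C (y :: 'a::complex_hilbert)"
  using scaleC_add_right[of c "x - y" y] by simp

lemma csubspace_imp_subspace: "csubspace D \<Longrightarrow> subspace D"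
  unfolding csubspace_def by (rule subspaceI) (auto simp flip: scaleC_of_real)

lemma cinner_left_eqI:
  assumes "\<And>x. cinner x y = cinner x z"
  shows "y = z"
proof -
  have "cinner (y - z) (y - z) = 0" using assms[of "y - z"] by (simp add: cinner_diff_right)
  then have "inner (y - z) (y - z) = 0" by (simp flip: Re_cinner)
  then show ?thesis by simp
qed

lemma bounded_selfadjointI:
  assumes bl: "bounded_linear S" and hom: "\<And>c x. S (c *\<^sub>C x) = c *\<^sub>C S x"
    and sym: "\<And>x y. inner (S x) y = inner x (S y)"
  shows "bounded_selfadjoint S"
proof -
  have csym: "cinner (S x) y = cinner x (S y)" for x y
    by (rule complex_eqI) (simp_all add: Re_cinner Im_cinner sym flip: hom)
  have "adjoint_op UNIV S g = S g" for g
    unfolding adjoint_op_def by (rule the_equality) (auto simp: csym intro: cinner_left_eqI)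
  moreover have "adjoint_dom UNIV S = UNIV" unfolding adjoint_dom_def by (auto simp: csym)
  ultimately show ?thesis
    using bl hom unfolding bounded_selfadjoint_def selfadjoint_def densely_defined_operator_def
    by (auto simp: csubspace_def clinear_on_def linear_add[OF bounded_linear.linear[OF bl]])
qed

lemma bounded_selfadjoint_sym:
  assumes "bounded_selfadjoint S"
  shows "cinner (S x) y = cinner x (S y)"
proof -
  have y: "y \<in> adjoint_dom UNIV S" and adj: "adjoint_op UNIV S y = S y"
    using assms by (auto simp: bounded_selfadjoint_def selfadjoint_def)
  then obtain h where h: "\<And>f. cinner (S f) y = cinner f h" by (auto simp: adjoint_dom_def)
  have "adjoint_op UNIV S y = h"
    unfolding adjoint_op_def by (rule the_equality) (auto simp: h intro: cinner_left_eqI)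
  then show ?thesis using h adj by simp
qed

lemma bounded_selfadjoint_sym_inner:
  "bounded_selfadjoint S \<Longrightarrow> inner (S x) y = inner x (S y)"
  by (simp add: bounded_selfadjoint_sym flip: Re_cinner)

section \<open>Monotone sequences of closed subspaces\<close>

text \<open>
  For nested projections \<open>P\<^sub>n\<close>, the squared distance of \<open>P\<^sub>m x\<close> and \<open>P\<^sub>n x\<close> is the difference of the
  squared norms, and these are monotone and bounded. Partial sums of orthogonal series behave in
  the same way.
\<close>

lemma convergent_of_norm_diff:
  fixes p :: "nat \<Rightarrow> 'a::banach"
  assumes "convergent a" "\<And>m n. m \<le> n \<Longrightarrow> (norm (p m - p n))\<^sup>2 = \<bar>a m - a n :: real\<bar>"
  shows "convergent p"
proof -
  have "Cauchy p"
  proof (rule CauchyI')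
    fix e :: real assume e: "0 < e"
    from assms(1) have "Cauchy a" by (rule convergent_Cauchy)
    with e obtain N where N: "\<And>m n. m \<ge> N \<Longrightarrow> n \<ge> N \<Longrightarrow> \<bar>a m - a n\<bar> < e\<^sup>2"
      unfolding Cauchy_iff by (metis real_norm_def zero_less_power)
    have "norm (p m - p n) < e" if "N \<le> m" "m < n" for m n
    proof -
      have "(norm (p m - p n))\<^sup>2 < e\<^sup>2" using N[of m n] assms(2)[of m n] that by simp
      then show ?thesis using e by (simp add: power_less_imp_less_base)
    qed
    then show "\<exists>M. \<forall>m\<ge>M. \<forall>n>m. dist (p m) (p n) < e" by (auto simp: dist_norm)
  qed
  then show ?thesis by (rule Cauchy_convergent)
qed

lemma orth_proj_decreasing:
  assumes cs: "\<And>n. closed_subspace (M n)" and dec: "\<And>m n. m \<le> n \<Longrightarrow> M n \<subseteq> M m"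
  shows "(\<lambda>n. orth_proj (M n) x) \<longlonglongrightarrow> orth_proj (\<Inter>n. M n) x"
proof -
  let ?p = "\<lambda>n. orth_proj (M n) x"
  have d: "(norm (?p m - ?p n))\<^sup>2 = (norm (?p m))\<^sup>2 - (norm (?p n))\<^sup>2" if "m \<le> n" for m n
    by (rule orth_proj_nested_diff[OF cs cs dec[OF that]])
  have "decseq (\<lambda>n. (norm (?p n))\<^sup>2)"
    unfolding decseq_def
  proof (intro allI impI)
    fix m n :: nat assume "m \<le> n" 
    from d[OF this] show "(norm (?p n))\<^sup>2 \<le> (norm (?p m))\<^sup>2"
      using zero_le_power2[of "norm (?p m - ?p n)"] by linarith
  qed
  then have "convergent (\<lambda>n. (norm (?p n))\<^sup>2)"
    using decseq_convergent[of "\<lambda>n. (norm (?p n))\<^sup>2" 0] unfolding convergent_def by (metis zero_le_power2)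
  then have "convergent ?p"
    by (rule convergent_of_norm_diff) (metis d abs_of_nonneg zero_le_power2)
  then obtain g where g: "?p \<longlonglongrightarrow> g" by (auto simp: convergent_def)
  interpret I: closed_subspace "\<Inter>n. M n"
    using cs by unfold_locales (auto simp: closed_subspace_def intro: subspace_Inter)
  have "orth_proj (\<Inter>n. M n) x = g"
  proof (rule I.orth_proj_unique)
    have "g \<in> M n" for n
    proof (rule closed_sequentially[OF closed_subspace.cl[OF cs] _ LIMSEQ_ignore_initial_segment[OF g, of n]])
      show "?p (k + n) \<in> M n" for k
        using dec[of n "k + n"] closed_subspace.orth_proj_mem[OF cs, of "k + n" x] by auto
    qed
    then show "g \<in> (\<Inter>n. M n)" by auto
    fix z assume z: "z \<in> (\<Inter>n. M n)"
    have "(\<lambda>n. inner (x - ?p n) z) \<longlonglongrightarrow> inner (x - g) z" by (intro tendsto_intros g)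
    moreover have "inner (x - ?p n) z = 0" for n
      using closed_subspace.orth_proj_orth[OF cs] z by auto
    ultimately show "inner (x - g) z = 0" by (simp add: LIMSEQ_const_iff)
  qed
  then show ?thesis using g by simp
qed

lemma orth_proj_increasing:
  assumes cs: "\<And>n. closed_subspace (M n)" and inc: "\<And>m n. m \<le> n \<Longrightarrow> M m \<subseteq> M n"
    and dense: "\<And>w. (\<And>n z. z \<in> M n \<Longrightarrow> inner w z = 0) \<Longrightarrow> w = 0"
  shows "(\<lambda>n. orth_proj (M n) x) \<longlonglongrightarrow> x"
proof -
  let ?p = "\<lambda>n. orth_proj (M n) x"
  have d: "(norm (?p n - ?p m))\<^sup>2 = (norm (?p n))\<^sup>2 - (norm (?p m))\<^sup>2" if "m \<le> n" for m n
    by (rule orth_proj_nested_diff[OF cs cs inc[OF that]])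
  have "incseq (\<lambda>n. (norm (?p n))\<^sup>2)"
    unfolding incseq_def
  proof (intro allI impI)
    fix m n :: nat assume "m \<le> n" 
    from d[OF this] show "(norm (?p m))\<^sup>2 \<le> (norm (?p n))\<^sup>2"
      using zero_le_power2[of "norm (?p n - ?p m)"] by linarith
  qed
  moreover have "(norm (?p n))\<^sup>2 \<le> (norm x)\<^sup>2" for n
    by (intro power_mono closed_subspace.orth_proj_norm_le[OF cs]) simp
  ultimately have "convergent (\<lambda>n. (norm (?p n))\<^sup>2)"
    using incseq_convergent[of "\<lambda>n. (norm (?p n))\<^sup>2" "(norm x)\<^sup>2"] unfolding convergent_def by metis
  then have "convergent ?p"
    by (rule convergent_of_norm_diff) (metis d norm_minus_commute abs_minus_commute abs_of_nonneg zero_le_power2)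
  then obtain g where g: "?p \<longlonglongrightarrow> g" by (auto simp: convergent_def)
  have "x - g = 0"
  proof (rule dense)
    fix n z assume z: "z \<in> M n"
    have "(\<lambda>k. inner (x - ?p (k + n)) z) \<longlonglongrightarrow> inner (x - g) z"
      by (intro tendsto_intros LIMSEQ_ignore_initial_segment g)
    moreover have "inner (x - ?p (k + n)) z = 0" for k
      using closed_subspace.orth_proj_orth[OF cs, of z "k + n"] inc[of n "k + n"] z by auto
    ultimately show "inner (x - g) z = 0" by (simp add: LIMSEQ_const_iff)
  qed
  then show ?thesis using g by simp
qed

section \<open>The spectral family of a nonnegative selfadjoint operator\<close>

text \<open>A possibly unbounded selfadjoint operator \<open>H \<ge> 0\<close> with domain \<open>D\<close>.\<close>

locale nonneg_selfadjoint =
  fixes D :: "'a::complex_hilbert set" and H :: "'a \<Rightarrow> 'a"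
  assumes sa: "selfadjoint D H" and ge0: "op_ge D H 0"
begin

lemma csub: "csubspace D" and dense: "closure D = UNIV"
  and H_add: "x \<in> D \<Longrightarrow> y \<in> D \<Longrightarrow> H (x + y) = H x + H y"
  and H_scaleC: "x \<in> D \<Longrightarrow> H (c *\<^sub>C x) = c *\<^sub>C H x"
  using sa by (auto simp: selfadjoint_def densely_defined_operator_def clinear_on_def)

lemma subD: "subspace D" by (rule csubspace_imp_subspace[OF csub])

lemma D_scaleC: "x \<in> D \<Longrightarrow> c *\<^sub>C x \<in> D" using csub by (auto simp: csubspace_def)

lemma H_scaleR: "x \<in> D \<Longrightarrow> H (c *\<^sub>R x) = c *\<^sub>R H x"
  using H_scaleC[of x "complex_of_real c"] by (simp add: scaleC_of_real)

lemma H_diff: "x \<in> D \<Longrightarrow> y \<in> D \<Longrightarrow> H (x - y) = H x - H y"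
  using H_add[of "x - y" y] subspace_diff[OF subD, of x y] by simp

lemma H_nonneg: "f \<in> D \<Longrightarrow> 0 \<le> inner (H f) f"
  using ge0 by (auto simp: op_ge_def Re_cinner)

lemma dense_eqI:
  assumes "\<And>f. f \<in> D \<Longrightarrow> inner f h = inner f k"
  shows "h = k"
proof -
  have "closed {f. inner f (h - k) = 0}" by (intro closed_Collect_eq continuous_intros)
  moreover have "D \<subseteq> {f. inner f (h - k) = 0}" using assms by (auto simp: inner_diff_right)
  ultimately have "closure D \<subseteq> {f. inner f (h - k) = 0}" by (rule closure_minimal[rotated])
  then have "inner (h - k) (h - k) = 0" using dense by blast
  then show ?thesis by simp
qed

text \<open>
  Selfadjointness, with the real inner product: the imaginary part of the complex identity is the
  real identity at \<open>\<i> f\<close>.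
\<close>

lemma adjointI:
  assumes "\<And>f. f \<in> D \<Longrightarrow> inner (H f) g = inner f h"
  shows "g \<in> D" "H g = h"
proof -
  have c: "cinner (H f) g = cinner f h" if "f \<in> D" for f
    by (rule complex_eqI) 
      (use that assms[of f] assms[of "\<i> *\<^sub>C f"] in \<open>auto simp: Re_cinner Im_cinner D_scaleC H_scaleC\<close>)
  then have "g \<in> adjoint_dom D H" by (auto simp: adjoint_dom_def)
  then show g: "g \<in> D" using sa by (auto simp: selfadjoint_def)
  have "adjoint_op D H g = h"
    unfolding adjoint_op_def
  proof (rule the_equality)
    fix k assume k: "\<forall>f\<in>D. cinner (H f) g = cinner f k"
    show "k = h"
      by (rule dense_eqI) (metis k c Re_cinner)
  qed (use c in auto)
  then show "H g = h" using sa g by (auto simp: selfadjoint_def)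
qed

lemma H_sym:
  assumes "f \<in> D" "g \<in> D"
  shows "inner (H f) g = inner f (H g)"
proof -
  have "g \<in> adjoint_dom D H" using sa assms by (auto simp: selfadjoint_def)
  then obtain h where h: "\<And>f. f \<in> D \<Longrightarrow> cinner (H f) g = cinner f h" by (auto simp: adjoint_dom_def)
  have h': "inner (H f) g = inner f h" if "f \<in> D" for f using h[OF that] by (metis Re_cinner)
  then show ?thesis using adjointI(2)[of g h] assms by simp
qed

lemma norm_le_1H:
  assumes "f \<in> D"
  shows "norm f \<le> norm (f + H f)"
proof (rule power2_le_imp_le)
  have "(norm (f + H f))\<^sup>2 = (norm f)\<^sup>2 + 2 * inner (H f) f + (norm (H f))\<^sup>2"
    by (simp add: power2_norm_eq_inner inner_add_left inner_add_right inner_commute)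
  then show "(norm f)\<^sup>2 \<le> (norm (f + H f))\<^sup>2" using H_nonneg[OF assms] by simp
qed simp

text \<open>Selfadjointness and \<open>H \<ge> 0\<close> make \<open>1 + H\<close> a bijection from \<open>D\<close> onto the whole space.\<close>

lemma onto_1H: "\<exists>f\<in>D. f + H f = x"
proof -
  define W where "W = (\<lambda>f. f + H f) ` D"
  interpret W: closed_subspace W
  proof
    show "subspace W"
      unfolding W_def
    proof (rule subspaceI)
      have "H 0 = 0" using H_scaleR[of 0 0] subspace_0[OF subD] by simp
      then show "0 \<in> (\<lambda>f. f + H f) ` D" using subspace_0[OF subD] by force
      show "y + z \<in> (\<lambda>f. f + H f) ` D" if yz: "y \<in> (\<lambda>f. f + H f) ` D" "z \<in> (\<lambda>f. f + H f) ` D" for y z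
      proof -
        obtain f g where "f \<in> D" "g \<in> D" "y = f + H f" "z = g + H g" using yz by auto
        then show ?thesis by (intro image_eqI[of _ _ "f + g"]) (auto simp: H_add subspace_add[OF subD])
      qed
      show "c *\<^sub>R y \<in> (\<lambda>f. f + H f) ` D" if y: "y \<in> (\<lambda>f. f + H f) ` D" for c y
      proof -
        obtain f where "f \<in> D" "y = f + H f" using y by auto
        then show ?thesis
          by (intro image_eqI[of _ _ "c *\<^sub>R f"]) (auto simp: H_scaleR subspace_scale[OF subD] scaleR_add_right)
      qed
    qed
    show "closed W"
      unfolding closed_sequential_limits
    proof (intro allI impI)
      fix y l assume "(\<forall>n. y n \<in> W) \<and> y \<longlonglongrightarrow> l"
      then have "\<forall>n. \<exists>f. f \<in> D \<and> y n = f + H f" and l: "y \<longlonglongrightarrow> l" by (auto simp: W_def)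
      then obtain f where fD: "\<And>n. f n \<in> D" and y: "\<And>n. y n = f n + H (f n)" by metis
      have "Cauchy f"
      proof (rule metric_CauchyI)
        fix e :: real assume "0 < e"
        then obtain N where N: "\<forall>m\<ge>N. \<forall>n\<ge>N. dist (y m) (y n) < e"
          using LIMSEQ_imp_Cauchy[OF l] unfolding Cauchy_def by metis
        have "dist (f m) (f n) \<le> dist (y m) (y n)" for m n
          using norm_le_1H[OF subspace_diff[OF subD fD[of m] fD[of n]]]
          by (simp add: dist_norm y H_diff fD algebra_simps)
        then show "\<exists>M. \<forall>m\<ge>M. \<forall>n\<ge>M. dist (f m) (f n) < e" using N by (meson le_less_trans)
      qed
      then obtain g where g: "f \<longlonglongrightarrow> g" using Cauchy_convergent convergent_def by blast
      have "(\<lambda>n. H (f n)) \<longlonglongrightarrow> l - g" using tendsto_diff[OF l g] by (simp add: y)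
      have "inner (H k) g = inner k (l - g)" if "k \<in> D" for k
      proof (rule LIMSEQ_unique)
        show "(\<lambda>n. inner (H k) (f n)) \<longlonglongrightarrow> inner (H k) g" by (intro tendsto_intros g)
        show "(\<lambda>n. inner (H k) (f n)) \<longlonglongrightarrow> inner k (l - g)"
          unfolding H_sym[OF that fD] by (intro tendsto_intros) fact
      qed
      from adjointI[OF this] show "l \<in> W" by (auto simp: W_def intro!: image_eqI[of _ _ g])
    qed
  qed
  \<comment> \<open>a vector \<open>w\<close> orthogonal to the range satisfies \<open>H w = - w\<close>, so that \<open>H \<ge> 0\<close> forces \<open>w = 0\<close>\<close>
  define w where "w = x - orth_proj W x"
  have "inner (H f) w = inner f (- w)" if "f \<in> D" for f
  proof -
    have "f + H f \<in> W" using that by (auto simp: W_def)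
    from W.orth_proj_orth[OF this, of x] show ?thesis
      by (simp add: w_def[symmetric] inner_add_right inner_commute)
  qed
  from adjointI[OF this] have "w \<in> D" "H w = - w" by auto
  with H_nonneg[of w] have "inner w w \<le> 0" by simp
  then have "w = 0" using inner_ge_zero[of w] by (simp add: order_antisym)
  then have "x = orth_proj W x" by (simp add: w_def)
  also have "\<dots> \<in> W" by (rule W.orth_proj_mem)
  finally show ?thesis by (auto simp: W_def)
qed

text \<open>The resolvent \<open>(1 + H)\<^sup>-\<^sup>1\<close> and the bounded transform \<open>H (1 + H)\<^sup>-\<^sup>1\<close>.\<close>

definition T :: "'a \<Rightarrow> 'a" where "T x = (SOME f. f \<in> D \<and> f + H f = x)"
definition R :: "'a \<Rightarrow> 'a" where "R x = H (T x)"

lemma T_mem: "T x \<in> D" and T_R: "T x + R x = x"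
proof -
  have "T x \<in> D \<and> T x + H (T x) = x"
    unfolding T_def by (rule someI_ex) (use onto_1H in blast)
  then show "T x \<in> D" "T x + R x = x" by (auto simp: R_def)
qed

lemma R_eq: "R x = x - T x" using T_R[of x] by (simp add: algebra_simps)

lemma T_unique:
  assumes f: "f \<in> D"
  shows "T (f + H f) = f"
proof -
  let ?g = "T (f + H f) - f"
  have "?g + H ?g = 0" 
    using T_R[of "f + H f"] by (simp add: H_diff T_mem f R_def algebra_simps)
  then show ?thesis using norm_le_1H[OF subspace_diff[OF subD T_mem f], of "f + H f"] by simp
qed

lemma T_eqI: "f \<in> D \<Longrightarrow> f + H f = x \<Longrightarrow> T x = f"
  using T_unique by blast

lemma T_add: "T (x + y) = T x + T y"
  by (rule T_eqI) (use T_R[of x] T_R[of y] in \<open>auto simp: T_mem H_add R_def subspace_add[OF subD] algebra_simps\<close>)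

lemma T_scaleC: "T (c *\<^sub>C x) = c *\<^sub>C T x"
  by (rule T_eqI) (use T_R[of x] in \<open>auto simp: T_mem H_scaleC D_scaleC R_def simp flip: scaleC_add_right\<close>)

lemma R_scaleC: "R (c *\<^sub>C x) = c *\<^sub>C R x"
  by (simp add: R_eq T_scaleC scaleC_diff_right)

lemma linear_R: "linear R"
  by (rule linearI) (simp_all add: R_eq T_add T_scaleC algebra_simps flip: scaleC_of_real scaleC_diff_right)

sublocale R: positive_contraction R
proof (rule positive_contraction.intro)
  show "linear R" by (rule linear_R)
  show "inner (R x) y = inner x (R y)" for x y
  proof -
    have "inner (R x) (T y + R y) = inner (T x + R x) (R y)"
      by (simp add: inner_add_left inner_add_right R_def H_sym T_mem)
    then show ?thesis by (simp add: T_R)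
  qed
  show "(norm (R x))\<^sup>2 \<le> inner (R x) x" for x
  proof -
    have "inner (R x) (T x + R x) = inner (R x) (T x) + (norm (R x))\<^sup>2"
      by (simp add: inner_add_right power2_norm_eq_inner)
    then show ?thesis using H_nonneg[OF T_mem, of x] unfolding T_R by (simp add: R_def)
  qed
qed

text \<open>
  \<open>F a\<close> is the spectral projector of \<open>H\<close> for \<open>(-\<infinity>,a]\<close>, and \<open>L a\<close> is its range. For \<open>a \<ge> 0\<close> the condition
  \<open>H \<le> a\<close> means \<open>H (1 + H)\<^sup>-\<^sup>1 \<le> a / (1 + a)\<close>; for \<open>a < 0\<close> the range is trivial since \<open>H \<ge> 0\<close>.
\<close>

definition L :: "real \<Rightarrow> 'a set" where
  "L a = (if a < 0 then {0} else R.low (a / (1 + a)))"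

definition F :: "real \<Rightarrow> 'a \<Rightarrow> 'a" where
  "F a = orth_proj (L a)"

lemma ratio_bounds: "0 \<le> a \<Longrightarrow> 0 \<le> a / (1 + a)" "0 \<le> a \<Longrightarrow> a / (1 + a) < (1::real)"
  by (auto simp: field_simps)

lemma ratio_cancel:
  assumes "0 \<le> a"
  shows "a / (1 + a) * p \<le> (1 - a / (1 + a)) * q \<longleftrightarrow> a * p \<le> (q::real)"
    "(1 - a / (1 + a)) * p \<le> a / (1 + a) * q \<longleftrightarrow> p \<le> a * (q::real)"
proof -
  have "1 - a / (1 + a) = 1 / (1 + a)" using assms by (simp add: field_simps)
  then show "a / (1 + a) * p \<le> (1 - a / (1 + a)) * q \<longleftrightarrow> a * p \<le> q"
    "(1 - a / (1 + a)) * p \<le> a / (1 + a) * q \<longleftrightarrow> p \<le> a * q"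
    using assms by (simp_all add: divide_le_cancel)
qed

lemma ratio_mono: "0 \<le> a \<Longrightarrow> a \<le> b \<Longrightarrow> a / (1 + a) \<le> b / (1 + b :: real)"
  by (auto simp: field_simps)

lemma closed_subspace_L: "closed_subspace (L a)"
  unfolding L_def using R.closed_subspace_low ratio_bounds
  by (auto intro!: closed_subspace.intro)

lemma L_mono: "a \<le> b \<Longrightarrow> L a \<subseteq> L b"
  using R.low_mono[of "a / (1 + a)" "b / (1 + b)"] ratio_mono[of a b] ratio_bounds[of a]
    closed_subspace.sub[OF closed_subspace_L, THEN subspace_0, of b] by (auto simp: L_def)

lemma L_R: "x \<in> L a \<Longrightarrow> R x \<in> L a"
  by (auto simp: L_def R.low_R linear_0[OF linear_R] split: if_splits)

lemma scaleC_zero: "c *\<^sub>C (0::'a) = 0"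
  using scaleC_diff_right[of c 0 "0::'a"] by simp

lemma L_scaleC: "x \<in> L a \<Longrightarrow> c *\<^sub>C x \<in> L a"
proof -
  have "linear (\<lambda>x::'a. c *\<^sub>C x)"
    by (rule linearI) (simp_all add: scaleC_add_right scaleC_scaleC mult.commute flip: scaleC_of_real)
  then show "x \<in> L a \<Longrightarrow> c *\<^sub>C x \<in> L a"
    using R.low_invariant[of "\<lambda>x. c *\<^sub>C x" "cmod c" x] by (auto simp: L_def scaleC_zero norm_scaleC R_scaleC split: if_splits)
qed

lemma L_Inter:
  assumes "\<And>n. a < s n" "s \<longlonglongrightarrow> a"
  shows "(\<Inter>n. L (s n)) = L a"
proof
  show "L a \<subseteq> (\<Inter>n. L (s n))" using L_mono assms(1) less_imp_le by blast
  show "(\<Inter>n. L (s n)) \<subseteq> L a"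
  proof
    fix f assume f: "f \<in> (\<Inter>n. L (s n))"
    show "f \<in> L a"
    proof (cases "a < 0")
      case True
      then have "\<forall>\<^sub>F n in sequentially. s n < 0" using order_tendstoD(2)[OF assms(2)] by blast
      then obtain n where "s n < 0" using eventually_sequentially by auto
      then show ?thesis using f True by (auto simp: L_def)
    next
      case False
      then have pos: "0 \<le> s n" for n using assms(1)[of n] by simp
      have "(\<lambda>n. s n / (1 + s n)) \<longlonglongrightarrow> a / (1 + a)"
        using False by (intro tendsto_intros assms(2)) auto
      moreover have "f \<in> R.low (s n / (1 + s n))" for n using f pos[of n] by (auto simp: L_def dest!: spec[of _ n])
      ultimately show ?thesis
        using R.low_Inter[of "\<lambda>n. s n / (1 + s n)"] pos ratio_bounds False by (auto simp: L_def)
    qed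
  qed
qed

text \<open>
  A vector \<open>w\<close> orthogonal to all \<open>L n\<close> satisfies \<open>R w = w\<close>, the limit of \<open>high_ineq\<close> as \<open>r\<close> tends to \<open>1\<close>.
  So it is annihilated by the injective operator \<open>T = 1 - R\<close>.
\<close>

lemma L_total:
  assumes w: "\<And>n::nat. \<And>z. z \<in> L (real n) \<Longrightarrow> inner w z = 0"
  shows "w = 0"
proof -
  have hi: "w \<in> R.high (real n / (1 + real n))" for n
    using w by (auto simp: R.high_def L_def)
  have le: "(norm (R w - (real n / (1 + real n)) *\<^sub>R w))\<^sup>2 \<le> 1 / (1 + real n) * (norm w)\<^sup>2" for n
  proof -
    let ?r = "real n / (1 + real n)"
    have r: "0 \<le> ?r" "?r \<le> 1" "1 - ?r = 1 / (1 + real n)" by (auto simp: field_simps)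
    have "(norm (R w - ?r *\<^sub>R w))\<^sup>2 \<le> (1 - ?r) * (inner (R w) w - ?r * (norm w)\<^sup>2)"
      by (rule R.high_ineq[OF r(1,2) hi])
    also have "\<dots> \<le> (1 - ?r) * (norm w)\<^sup>2"
      using r R.le_norm_sq[of w] mult_nonneg_nonneg[OF r(1) zero_le_power2[of "norm w"]]
      by (intro mult_left_mono) linarith+
    finally show ?thesis using r(3) by simp
  qed
  have r1: "(\<lambda>n. real n / (1 + real n)) \<longlonglongrightarrow> 1"
    using LIMSEQ_n_over_Suc_n by simp
  have "(\<lambda>n. (norm (R w - (real n / (1 + real n)) *\<^sub>R w))\<^sup>2) \<longlonglongrightarrow> (norm (R w - 1 *\<^sub>R w))\<^sup>2"
    by (intro tendsto_intros r1)
  moreover have "(\<lambda>n. 1 / (1 + real n) * (norm w)\<^sup>2) \<longlonglongrightarrow> 0 * (norm w)\<^sup>2"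
    using LIMSEQ_inverse_real_of_nat by (intro tendsto_intros) (simp add: inverse_eq_divide)
  ultimately have "(norm (R w - 1 *\<^sub>R w))\<^sup>2 \<le> 0 * (norm w)\<^sup>2"
    by (rule LIMSEQ_le) (use le in auto)
  then have "T w = 0" by (simp add: R_eq)
  then show "w = 0" using T_R[of w] H_scaleR[of 0 0] subspace_0[OF subD] by (simp add: R_def)
qed

lemma F_mem: "F a x \<in> L a" unfolding F_def by (rule closed_subspace.orth_proj_mem[OF closed_subspace_L])
lemma F_id: "x \<in> L a \<Longrightarrow> F a x = x" unfolding F_def by (rule closed_subspace.orth_proj_id[OF closed_subspace_L])
lemma linear_F: "linear (F a)" unfolding F_def by (rule closed_subspace.linear_orth_proj[OF closed_subspace_L])
lemma F_sym: "inner (F a x) y = inner x (F a y)" unfolding F_def by (rule closed_subspace.orth_proj_sym[OF closed_subspace_L])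
lemma F_idem: "F a (F a x) = F a x" unfolding F_def by (rule closed_subspace.orth_proj_idem[OF closed_subspace_L])
lemma F_norm: "(norm (F a x))\<^sup>2 = inner (F a x) x" unfolding F_def by (rule closed_subspace.orth_proj_norm[OF closed_subspace_L])
lemma F_norm_le: "norm (F a x) \<le> norm x" unfolding F_def by (rule closed_subspace.orth_proj_norm_le[OF closed_subspace_L])

lemma F_nested: "a \<le> b \<Longrightarrow> F a (F b x) = F a x" "a \<le> b \<Longrightarrow> F b (F a x) = F a x"
  unfolding F_def by (rule orth_proj_nested[OF closed_subspace_L closed_subspace_L L_mono]; simp)+

lemma F_norm_diff: "a \<le> b \<Longrightarrow> (norm (F b x - F a x))\<^sup>2 = (norm (F b x))\<^sup>2 - (norm (F a x))\<^sup>2"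
  unfolding F_def by (rule orth_proj_nested_diff[OF closed_subspace_L closed_subspace_L L_mono])

lemma F_norm_mono: "a \<le> b \<Longrightarrow> (norm (F a x))\<^sup>2 \<le> (norm (F b x))\<^sup>2"
  using F_norm_diff[of a b x] zero_le_power2[of "norm (F b x - F a x)"] by linarith

lemma F_neg: "a < 0 \<Longrightarrow> F a x = 0"
  using F_mem[of a x] by (simp add: L_def)

lemma F_scaleC: "F a (c *\<^sub>C x) = c *\<^sub>C F a x"
proof -
  interpret M: closed_subspace "L a" by (rule closed_subspace_L)
  show ?thesis
    unfolding F_def
  proof (rule M.orth_proj_unique)
    fix z assume z: "z \<in> L a"
    show "inner (c *\<^sub>C x - c *\<^sub>C orth_proj (L a) x) z = 0"
      using M.orth_proj_orth[OF L_scaleC[OF z]] by (simp add: inner_scaleC_left flip: scaleC_diff_right)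
  qed (simp add: L_scaleC M.orth_proj_mem)
qed

lemma F_tendsto: "(\<lambda>n. F (real n) x) \<longlonglongrightarrow> x"
  unfolding F_def by (rule orth_proj_increasing[OF closed_subspace_L L_mono]) (use L_total in auto)

lemma F_tendsto_right:
  assumes "\<And>n. a < s n" "s \<longlonglongrightarrow> a" "decseq s"
  shows "(\<lambda>n. F (s n) x) \<longlonglongrightarrow> F a x"
  using orth_proj_decreasing[of "\<lambda>n. L (s n)" x] L_Inter[OF assms(1,2)] closed_subspace_L L_mono assms(3)
  unfolding F_def decseq_def by metis

lemma F_R: "F a (R x) = R (F a x)"
  unfolding F_def by (rule closed_subspace.orth_proj_commute[OF closed_subspace_L linear_R R.sym L_R])

lemma F_T: "F a (T x) = T (F a x)"
  using F_R[of a x] by (simp add: R_eq linear_diff[OF linear_F])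

lemma F_H:
  assumes f: "f \<in> D"
  shows "F a f \<in> D" "H (F a f) = F a (H f)"
proof -
  have eq: "F a f = T (F a (f + H f))" using F_T[of a "f + H f"] by (simp add: T_unique[OF f])
  then show "F a f \<in> D" by (simp add: T_mem)
  have "H (F a f) = R (F a (f + H f))" using eq by (simp add: R_def)
  also have "\<dots> = F a (R (f + H f))" by (simp add: F_R)
  also have "R (f + H f) = H f" by (simp add: R_eq T_unique[OF f])
  finally show "H (F a f) = F a (H f)" .
qed

text \<open>On the range of \<open>F a\<close>, the operator \<open>H\<close> is defined and bounded by \<open>a\<close>.\<close>

lemma L_bound:
  assumes a: "0 \<le> a" and f: "f \<in> L a"
  shows "f \<in> D" "norm (H f) \<le> a * norm f"
proof -
  let ?r = "a / (1 + a)"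
  have r: "0 \<le> ?r" "?r < 1" "f \<in> R.low ?r" using ratio_bounds[OF a] a f by (auto simp: L_def)
  obtain g where g: "g - R g = f" "(1 - ?r) * norm (R g) \<le> ?r * norm f"
    using R.low_inverse[OF r] by blast
  have f_eq: "f = T g" using g(1) T_R[of g] by (metis add_diff_cancel_right')
  then show "f \<in> D" by (simp add: T_mem)
  show "norm (H f) \<le> a * norm f"
    using g(2) ratio_cancel(2)[OF a] by (simp add: f_eq R_def)
qed

text \<open>On the orthogonal complement of the range of \<open>F a\<close> one has \<open>H \<ge> a\<close>.\<close>

lemma lower_bound:
  assumes a: "0 \<le> a" and f: "f \<in> D" and Ff: "F a f = 0"
  shows "a * (norm f)\<^sup>2 \<le> inner (H f) f"
proof -
  let ?r = "a / (1 + a)"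
  have r: "0 \<le> ?r" "?r \<le> 1" using ratio_bounds[OF a] by auto
  let ?g = "f + H f"
  have Rg: "R ?g = H f" "?g - R ?g = f" by (simp_all add: R_eq T_unique[OF f])
  have "F a ?g = 0"
    using F_H[OF f, of a] Ff H_scaleR[of 0 0] subspace_0[OF subD] by (simp add: linear_add[OF linear_F])
  have "inner ?g z = 0" if "z \<in> L a" for z
  proof -
    have "inner ?g z = inner (F a ?g) z" using that by (simp add: F_sym F_id)
    then show ?thesis using \<open>F a ?g = 0\<close> by simp
  qed
  then have "?g \<in> R.high ?r" using a by (auto simp: R.high_def L_def)
  from R.high_lower_bound[OF r this, unfolded Rg(2), unfolded Rg(1)]
  have "?r * (norm f)\<^sup>2 \<le> (1 - ?r) * inner (H f) f" .
  then show ?thesis using ratio_cancel(1)[OF a] by simp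
qed

end

section \<open>Sums of orthogonal projections\<close>

lemma orthogonal_projectionI:
  assumes lin: "linear P" and hom: "\<And>c x. P (c *\<^sub>C x) = c *\<^sub>C P x"
    and sym: "\<And>x y. inner (P x) y = inner x (P y)" and idem: "\<And>x. P (P x) = P x"
  shows "orthogonal_projection P"
proof -
  have "norm (P x) \<le> norm x" for x
  proof (cases "P x = 0")
    case False
    have "norm (P x) * norm (P x) = inner x (P x)"
      using sym[of x "P x"] by (simp add: idem power2_norm_eq_inner flip: power2_eq_square)
    also have "\<dots> \<le> norm x * norm (P x)" by (rule norm_cauchy_schwarz)
    finally show ?thesis using False by simp
  qed simp
  then have "bounded_linear P"
    by (intro bounded_linear_intro[of _ 1]) (auto simp: linear_add[OF lin] linear_cmul[OF lin])
  then have "bounded_selfadjoint P" by (rule bounded_selfadjointI) (simp_all add: hom sym)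
  then show ?thesis by (simp add: orthogonal_projection_def fun_eq_iff idem)
qed

context
  fixes P :: "'a::complex_hilbert \<Rightarrow> 'a"
  assumes P: "orthogonal_projection P"
begin

lemma proj_bounded_linear: "bounded_linear P"
  and proj_linear: "linear P"
  and proj_scaleC: "P (c *\<^sub>C x) = c *\<^sub>C P x"
  and proj_sym: "inner (P x) y = inner x (P y)"
  and proj_idem: "P (P x) = P x"
proof -
  have b: "bounded_selfadjoint P" and i: "P \<circ> P = P" using P by (auto simp: orthogonal_projection_def)
  then show "bounded_linear P" by (simp add: bounded_selfadjoint_def)
  then show "linear P" by (rule bounded_linear.linear)
  show "P (c *\<^sub>C x) = c *\<^sub>C P x"
    using b by (auto simp: bounded_selfadjoint_def selfadjoint_def densely_defined_operator_def clinear_on_def)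
  show "inner (P x) y = inner x (P y)" by (rule bounded_selfadjoint_sym_inner[OF b])
  show "P (P x) = P x" using i by (metis o_apply)
qed

lemma proj_norm: "inner (P x) x = (norm (P x))\<^sup>2"
  using proj_sym[of "P x" x] by (simp add: proj_idem power2_norm_eq_inner)

lemma proj_compl: "orthogonal_projection (\<lambda>x. x - P x)"
  by (rule orthogonal_projectionI)
    (simp_all add: proj_scaleC scaleC_diff_right inner_diff_left inner_diff_right proj_sym
      linear_diff[OF proj_linear] proj_idem linear_compose_sub linear_ident proj_linear)

lemma proj_pythagoras: "(norm x)\<^sup>2 = (norm (P x))\<^sup>2 + (norm (x - P x))\<^sup>2"
proof -
  have "(norm (x - p))\<^sup>2 = (norm x)\<^sup>2 - 2 * inner p x + (norm p)\<^sup>2" for p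
    by (simp add: power2_norm_eq_inner algebra_simps inner_commute)
  from this[of "P x"] show ?thesis using proj_norm[of x] by simp
qed

end

text \<open>Two projections with \<open>P + Q \<le> 1\<close> are orthogonal to each other.\<close>

lemma proj_orthogonal_of_le:
  assumes P: "orthogonal_projection P" and Q: "orthogonal_projection Q"
    and le: "\<And>x. inner (P x) x + inner (Q x) x \<le> (norm x)\<^sup>2"
  shows "P (Q x) = 0"
proof -
  have "(norm (P (Q x)))\<^sup>2 + (norm (Q x))\<^sup>2 \<le> (norm (Q x))\<^sup>2"
    using le[of "Q x"] unfolding proj_norm[OF P] proj_idem[OF Q] power2_norm_eq_inner[of "Q x"] .
  then show ?thesis by simp
qed

lemma symmetric_eqI:
  fixes A B :: "'a::real_inner \<Rightarrow> 'a"
  assumes "linear A" "linear B" "\<And>x y. inner (A x) y = inner x (A y)" "\<And>x y. inner (B x) y = inner x (B y)"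
    and eq: "\<And>x. inner (A x) x = inner (B x) x"
  shows "A = B"
proof
  fix x
  have "inner (A x) y = inner (B x) y" for y
  proof -
    have "inner (A (x + y)) (x + y) = inner (A x) x + 2 * inner (A x) y + inner (A y) y"
      using assms(3)[of y x] by (simp add: linear_add[OF assms(1)] inner_add_left inner_add_right inner_commute)
    moreover have "inner (B (x + y)) (x + y) = inner (B x) x + 2 * inner (B x) y + inner (B y) y"
      using assms(4)[of y x] by (simp add: linear_add[OF assms(2)] inner_add_left inner_add_right inner_commute)
    ultimately show ?thesis using eq[of x] eq[of y] eq[of "x + y"] by linarith
  qed
  then have "inner (A x - B x) (A x - B x) = 0" by (simp add: inner_diff_left)
  then show "A x = B x" by simp
qed

lemma proj_eqI:
  assumes "orthogonal_projection P" "orthogonal_projection Q" "\<And>x. inner (P x) x = inner (Q x) x"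
  shows "P = Q"
  by (rule symmetric_eqI) (use assms in \<open>auto intro: proj_linear proj_sym\<close>)

lemma proj_suminf:
  fixes P :: "nat \<Rightarrow> 'a::complex_hilbert \<Rightarrow> 'a"
  assumes P: "\<And>n. orthogonal_projection (P n)"
    and le: "\<And>n x. (\<Sum>i<n. inner (P i x) x) \<le> (norm x)\<^sup>2"
  shows "summable (\<lambda>n. P n x)" "orthogonal_projection (\<lambda>x. \<Sum>n. P n x)"
    "(\<lambda>n. inner (P n x) x) sums inner (\<Sum>n. P n x) x"
proof -
  have orth: "P i (P j x) = 0" if "i \<noteq> j" for i j x
  proof (rule proj_orthogonal_of_le[OF P P])
    fix x
    have "inner (P i x) x + inner (P j x) x = (\<Sum>k\<in>{i,j}. inner (P k x) x)" using that by simp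
    also have "\<dots> \<le> (\<Sum>k<Suc (max i j). inner (P k x) x)"
      by (rule sum_mono2) (auto simp: proj_norm[OF P])
    also have "\<dots> \<le> (norm x)\<^sup>2" by (rule le)
    finally show "inner (P i x) x + inner (P j x) x \<le> (norm x)\<^sup>2" .
  qed
  have "convergent (\<lambda>n. \<Sum>i<n. P i x)" for x
  proof (rule convergent_of_norm_diff)
    show "convergent (\<lambda>n. \<Sum>i<n. inner (P i x) x)"
      by (intro summable_iff_convergent[THEN iffD1] bounded_imp_summable[of _ "(norm x)\<^sup>2"])
        (use le[of x "Suc _"] in \<open>auto simp: proj_norm[OF P] lessThan_Suc_atMost\<close>)
    fix m n :: nat assume mn: "m \<le> n"
    have split: "(\<Sum>i<n. P i x) = (\<Sum>i<m. P i x) + (\<Sum>i\<in>{m..<n}. P i x)"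
      "(\<Sum>i<n. inner (P i x) x) = (\<Sum>i<m. inner (P i x) x) + (\<Sum>i\<in>{m..<n}. inner (P i x) x)"
      using mn by (simp_all add: lessThan_atLeast0 sum.atLeastLessThan_concat)
    have "(norm (\<Sum>i\<in>{m..<n}. P i x))\<^sup>2 = (\<Sum>i\<in>{m..<n}. (norm (P i x))\<^sup>2)"
      by (rule norm_sum_Pythagorean) (auto simp: pairwise_def orthogonal_def proj_sym[OF P] orth)
    then show "(norm ((\<Sum>i<m. P i x) - (\<Sum>i<n. P i x)))\<^sup>2 = \<bar>(\<Sum>i<m. inner (P i x) x) - (\<Sum>i<n. inner (P i x) x)\<bar>"
      unfolding split by (simp add: proj_norm[OF P] sum_nonneg)
  qed
  then have summ: "summable (\<lambda>n. P n x)" for x by (simp add: summable_iff_convergent)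
  then show "summable (\<lambda>n. P n x)" .
  define S where "S x = (\<Sum>n. P n x)" for x
  have S: "(\<lambda>n. P n x) sums S x" for x unfolding S_def by (rule summable_sums[OF summ])
  have inner_S: "(\<lambda>n. inner (P n x) y) sums inner (S x) y" for x y
    by (rule bounded_linear.sums[OF bounded_linear_inner_left S])
  show "(\<lambda>n. inner (P n x) x) sums inner (\<Sum>n. P n x) x" using inner_S[of x x] by (simp add: S_def)
  have PS: "P i (S x) = P i x" for i x
  proof -
    have "(\<lambda>n. P i (P n x)) sums P i (S x)"
      by (rule bounded_linear.sums[OF proj_bounded_linear[OF P] S])
    moreover have "(\<lambda>n. P i (P n x)) = (\<lambda>n. if n = i then P i x else 0)"
      using orth by (auto simp: proj_idem[OF P])
    moreover have "(\<lambda>n. if n = i then P i x else 0) sums P i x" by (rule sums_single)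
    ultimately show ?thesis by (metis sums_unique2)
  qed
  have "orthogonal_projection S"
  proof (rule orthogonal_projectionI)
    show "linear S"
    proof (rule linearI)
      show "S (x + y) = S x + S y" for x y
        using sums_add[OF S[of x] S[of y]] S[of "x + y"] by (simp add: linear_add[OF proj_linear[OF P]] sums_unique2)
      show "S (c *\<^sub>R x) = c *\<^sub>R S x" for c x
        using sums_scaleR_right[OF S[of x], of c] S[of "c *\<^sub>R x"] by (simp add: linear_cmul[OF proj_linear[OF P]] sums_unique2)
    qed
    show "S (c *\<^sub>C x) = c *\<^sub>C S x" for c x
    proof -
      have "bounded_linear (\<lambda>x::'a. c *\<^sub>C x)"
        by (rule bounded_linear_intro[of _ "cmod c"])
          (simp_all add: scaleC_add_right scaleC_scaleC norm_scaleC mult.commute flip: scaleC_of_real)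
      from bounded_linear.sums[OF this S[of x]] S[of "c *\<^sub>C x"] show ?thesis
        by (simp add: proj_scaleC[OF P] sums_unique2)
    qed
    show "inner (S x) y = inner x (S y)" for x y
    proof -
      have "inner (P n x) y = inner (P n y) x" for n by (metis proj_sym[OF P] inner_commute)
      then have "inner (S x) y = inner (S y) x"
        using inner_S[of x y] inner_S[of y x] by (simp add: sums_unique2)
      then show ?thesis by (simp add: inner_commute)
    qed
    show "S (S x) = S x" for x
      using S[of "S x"] S[of x] by (simp add: PS sums_unique2)
  qed
  then show "orthogonal_projection (\<lambda>x. \<Sum>n. P n x)" by (simp add: S_def[abs_def])
qed

section \<open>The spectral measure\<close>

context nonneg_selfadjoint
begin

text \<open>The Stieltjes measure of \<open>a \<mapsto> \<parallel>F a f\<parallel>\<^sup>2\<close>; it is the scalar spectral measure of \<open>H\<close> at \<open>f\<close>.\<close>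

definition \<mu> :: "'a \<Rightarrow> real measure" where
  "\<mu> f = interval_measure (\<lambda>a. (norm (F a f))\<^sup>2)"

lemma F_norm_right_cont: "continuous (at_right a) (\<lambda>a. (norm (F a f))\<^sup>2)"
  unfolding continuous_within
  by (rule tendsto_at_right_sequentially[of a "a + 1"]) (auto intro!: tendsto_intros F_tendsto_right)

lemma F_norm_at_bot: "((\<lambda>a. (norm (F a f))\<^sup>2) \<longlongrightarrow> 0) at_bot"
proof (rule tendsto_eventually)
  show "\<forall>\<^sub>F a in at_bot. (norm (F a f))\<^sup>2 = 0"
    using eventually_gt_at_bot[of "0::real"] eventually_at_bot_dense[of "\<lambda>a. (norm (F a f))\<^sup>2 = 0"]
    by (auto simp: F_neg intro!: exI[of _ 0])
qed

lemma F_norm_at_top: "((\<lambda>a. (norm (F a f))\<^sup>2) \<longlongrightarrow> (norm f)\<^sup>2) at_top"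
proof (rule increasing_tendsto)
  show "\<forall>\<^sub>F a in at_top. (norm (F a f))\<^sup>2 \<le> (norm f)\<^sup>2"
    by (intro always_eventually allI power_mono F_norm_le) simp
  fix y assume "y < (norm f)\<^sup>2"
  moreover have "(\<lambda>n. (norm (F (real n) f))\<^sup>2) \<longlonglongrightarrow> (norm f)\<^sup>2" by (intro tendsto_intros F_tendsto)
  ultimately have "\<forall>\<^sub>F n in sequentially. y < (norm (F (real n) f))\<^sup>2" by (simp add: order_tendstoD)
  then obtain n where "y < (norm (F (real n) f))\<^sup>2" using eventually_sequentially by auto
  then have "y < (norm (F a f))\<^sup>2" if "real n \<le> a" for a
    using F_norm_mono[OF that, of f] by linarith
  then show "\<forall>\<^sub>F a in at_top. y < (norm (F a f))\<^sup>2" unfolding eventually_at_top_linorder by blast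
qed

lemma finite_mu: "finite_borel_measure (\<mu> f)"
  unfolding \<mu>_def by (rule finite_borel_measure_interval_measure[OF F_norm_mono F_norm_right_cont F_norm_at_bot F_norm_at_top]) auto

lemma finite_measure_mu: "finite_measure (\<mu> f)"
  using finite_mu by (simp add: finite_borel_measure_def)

lemma sets_mu [simp, measurable_cong]: "sets (\<mu> f) = sets borel" and space_mu [simp]: "space (\<mu> f) = UNIV"
  by (simp_all add: \<mu>_def)

lemma mu_UNIV: "measure (\<mu> f) UNIV = (norm f)\<^sup>2"
  using interval_measure_UNIV[OF F_norm_mono F_norm_right_cont F_norm_at_bot F_norm_at_top, of f]
  by (simp add: \<mu>_def measure_def)

lemma mu_Iic: "measure (\<mu> f) {..a} = (norm (F a f))\<^sup>2"
  unfolding \<mu>_def by (rule measure_interval_measure_Iic[OF F_norm_mono F_norm_right_cont F_norm_at_bot])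

text \<open>
  The Borel sets \<open>B\<close> for which \<open>f \<mapsto> \<mu> f B\<close> is the quadratic form of an orthogonal projection form a
  Dynkin system, because projections whose sum is at most \<open>1\<close> are orthogonal to each other.
\<close>

lemma spectral_projection_exists:
  assumes "B \<in> sets borel"
  shows "\<exists>P. orthogonal_projection P \<and> (\<forall>f. inner (P f) f = measure (\<mu> f) B)"
proof -
  have int: "Int_stable (range (\<lambda>a::real. {..a}))" by (auto simp: Int_stable_def)
  have sub: "range (\<lambda>a::real. {..a}) \<subseteq> Pow UNIV" by simp
  have "B \<in> sigma_sets UNIV (range (\<lambda>a::real. {..a}))"
    using assms by (simp add: borel_eq_atMost)
  from int sub this show ?thesis
  proof (induction rule: sigma_sets_induct_disjoint)
    case (basic A)
    then obtain a where a: "A = {..a}" by auto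
    have "orthogonal_projection (F a)"
      by (rule orthogonal_projectionI) (simp_all add: linear_F F_scaleC F_sym F_idem)
    then show ?case by (auto simp: a mu_Iic F_norm)
  next
    case empty
    have "orthogonal_projection (\<lambda>x::'a. 0)"
      by (rule orthogonal_projectionI) (simp_all add: scaleC_zero linear_zero)
    then show ?case by auto
  next
    case (compl A)
    then obtain P where P: "orthogonal_projection P" "\<And>f. inner (P f) f = measure (\<mu> f) A" by auto
    have A: "A \<in> sets borel" using compl(1) by (simp add: borel_eq_atMost)
    have "measure (\<mu> f) (UNIV - A) = (norm f)\<^sup>2 - measure (\<mu> f) A" for f
      using finite_measure.finite_measure_compl[OF finite_measure_mu, of A f] A by (simp add: mu_UNIV)
    then show ?case
      using proj_compl[OF P(1)] by (intro exI[of _ "\<lambda>x. x - P x"]) (simp add: inner_diff_left P(2) power2_norm_eq_inner)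
  next
    case (union A)
    then obtain P where P: "\<And>n. orthogonal_projection (P n)" "\<And>n f. inner (P n f) f = measure (\<mu> f) (A n)" by metis
    have A: "range A \<subseteq> sets borel" using union(2) by (simp add: borel_eq_atMost)
    have le: "(\<Sum>i<n. inner (P i f) f) \<le> (norm f)\<^sup>2" for n f
    proof -
      have "(\<Sum>i<n. inner (P i f) f) = measure (\<mu> f) (\<Union>i<n. A i)"
        unfolding P(2)
        by (rule finite_measure.finite_measure_finite_Union[symmetric, OF finite_measure_mu])
          (use A union(1) in \<open>auto simp: disjoint_family_on_def\<close>)
      also have "\<dots> \<le> measure (\<mu> f) (space (\<mu> f))" by (rule finite_measure.bounded_measure[OF finite_measure_mu])
      finally show ?thesis by (simp add: mu_UNIV)
    qed
    have "inner (\<Sum>n. P n f) f = measure (\<mu> f) (\<Union>n. A n)" for f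
      using proj_suminf(3)[of P, OF P(1) le, of f] 
        finite_measure.finite_measure_UNION[OF finite_measure_mu, of A f] A union(1)
      by (simp add: P(2) sums_unique2)
    then show ?case using proj_suminf(2)[of P, OF P(1) le] by blast
  qed
qed

text \<open>The spectral measure of \<open>H\<close>. Its values on sets that are not Borel are irrelevant.\<close>

definition Q :: "real set \<Rightarrow> 'a \<Rightarrow> 'a" where
  "Q B = (SOME P. orthogonal_projection P \<and> (\<forall>f. inner (P f) f = measure (\<mu> f) B))"

lemma Q_proj: "B \<in> sets borel \<Longrightarrow> orthogonal_projection (Q B)"
  and Q_form: "B \<in> sets borel \<Longrightarrow> inner (Q B f) f = measure (\<mu> f) B"
proof -
  assume B: "B \<in> sets borel"
  have "orthogonal_projection (Q B) \<and> (\<forall>f. inner (Q B f) f = measure (\<mu> f) B)"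
    unfolding Q_def by (rule someI_ex[OF spectral_projection_exists[OF B]])
  then show "orthogonal_projection (Q B)" "inner (Q B f) f = measure (\<mu> f) B" by auto
qed

lemma projection_valued_measure_Q: "projection_valued_measure Q"
  unfolding projection_valued_measure_def
proof (intro conjI ballI allI impI)
  show "orthogonal_projection (Q B)" if "B \<in> sets borel" for B by (rule Q_proj[OF that])
  have "orthogonal_projection (id :: 'a \<Rightarrow> 'a)"
    by (rule orthogonal_projectionI) (simp_all add: linear_id)
  then show "Q UNIV = id"
    by (intro proj_eqI Q_proj) (simp_all add: Q_form mu_UNIV power2_norm_eq_inner)
  fix B :: "nat \<Rightarrow> real set" and f
  assume B: "range B \<subseteq> sets borel" and disj: "disjoint_family B"
  have Bn: "B n \<in> sets borel" for n using B by auto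
  have le: "(\<Sum>i<n. inner (Q (B i) f) f) \<le> (norm f)\<^sup>2" for n f
  proof -
    have "(\<Sum>i<n. inner (Q (B i) f) f) = measure (\<mu> f) (\<Union>i<n. B i)"
      unfolding Q_form[OF Bn]
      by (rule finite_measure.finite_measure_finite_Union[symmetric, OF finite_measure_mu])
        (use B disj in \<open>auto simp: disjoint_family_on_def\<close>)
    also have "\<dots> \<le> measure (\<mu> f) (space (\<mu> f))" by (rule finite_measure.bounded_measure[OF finite_measure_mu])
    finally show ?thesis by (simp add: mu_UNIV)
  qed
  note sm = proj_suminf[of "\<lambda>n. Q (B n)", OF Q_proj[OF Bn] le]
  have U: "(\<Union>n. B n) \<in> sets borel" using Bn by auto
  have "(\<lambda>f. \<Sum>n. Q (B n) f) = Q (\<Union>n. B n)"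
  proof (rule proj_eqI[OF sm(2) Q_proj[OF U]])
    fix f
    show "inner (\<Sum>n. Q (B n) f) f = inner (Q (\<Union>n. B n) f) f"
      using sm(3)[of f] finite_measure.finite_measure_UNION[OF finite_measure_mu, of B f] B disj U
      by (simp add: Q_form Bn sums_unique2)
  qed
  then show "(\<lambda>n. Q (B n) f) sums Q (\<Union>n. B n) f"
    using summable_sums[OF sm(1), of f] by (simp add: fun_eq_iff)
qed

lemma scalar_measure_Q: "scalar_measure Q f = \<mu> f"
proof -
  have "scalar_measure Q f = measure_of (space (\<mu> f)) (sets (\<mu> f)) (emeasure (\<mu> f))"
    unfolding scalar_measure_def space_mu sets_mu
  proof (rule measure_of_eq)
    fix B :: "real set" assume "B \<in> sigma_sets UNIV (sets borel)"
    then have "B \<in> sets borel" using sets.sigma_sets_eq[of "borel :: real measure"] by simp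
    then show "ennreal (Re (cinner (Q B f) f)) = emeasure (\<mu> f) B"
      by (simp add: Re_cinner Q_form finite_measure.emeasure_eq_measure[OF finite_measure_mu])
  qed simp
  then show ?thesis by (simp add: measure_of_of_measure del: space_mu sets_mu)
qed

end

section \<open>The spectral integral\<close>

text \<open>
  A function whose increments are \<open>O(\<Delta>x \<cdot> \<Delta>m)\<close>, \<open>m\<close> being a fixed real function, does not change:
  divide the interval into \<open>n\<close> equal parts.
\<close>

lemma constant_of_increment_bound:
  fixes \<phi> m :: "real \<Rightarrow> real"
  assumes ab: "a \<le> b"
    and inc: "\<And>x y. a \<le> x \<Longrightarrow> x \<le> y \<Longrightarrow> y \<le> b \<Longrightarrow> \<bar>\<phi> y - \<phi> x\<bar> \<le> K * (y - x) * (m y - m x)"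
  shows "\<phi> b = \<phi> a"
proof -
  have "\<bar>\<phi> b - \<phi> a\<bar> \<le> inverse (real (Suc k)) * (K * (b - a) * (m b - m a))" for k
  proof -
    define n where "n = Suc k"
    define t where "t i = a + real i * ((b - a) / n)" for i :: nat
    have t0: "t 0 = a" and tn: "t n = b" by (simp_all add: t_def n_def)
    have t_Suc: "t (Suc i) - t i = (b - a) / n" for i 
      by (simp add: t_def distrib_right add_divide_distrib)
    have t_lower: "a \<le> t i" for i using ab by (simp add: t_def)
    have t_upper: "t i \<le> b" if "i \<le> n" for i
    proof -
      have "real i * ((b - a) / n) \<le> real n * ((b - a) / n)"
        using ab that by (intro mult_right_mono) auto
      then show ?thesis using tn by (simp add: t_def)
    qed
    have "\<phi> b - \<phi> a = (\<Sum>i<n. \<phi> (t (Suc i)) - \<phi> (t i))"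
      using sum_lessThan_telescope[of "\<lambda>i. \<phi> (t i)" n] by (simp add: t0 tn)
    then have "\<bar>\<phi> b - \<phi> a\<bar> \<le> (\<Sum>i<n. \<bar>\<phi> (t (Suc i)) - \<phi> (t i)\<bar>)" by simp
    also have "\<dots> \<le> (\<Sum>i<n. K * ((b - a) / n) * (m (t (Suc i)) - m (t i)))"
    proof (rule sum_mono)
      fix i assume "i \<in> {..<n}"
      moreover have "t i \<le> t (Suc i)" using t_Suc[of i] ab by (simp add: algebra_simps divide_nonneg_nonneg)
      ultimately show "\<bar>\<phi> (t (Suc i)) - \<phi> (t i)\<bar> \<le> K * ((b - a) / n) * (m (t (Suc i)) - m (t i))"
        using inc[of "t i" "t (Suc i)"] t_lower t_upper[of "Suc i"] t_Suc[of i] by simp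
    qed
    also have "\<dots> = K * ((b - a) / n) * (m b - m a)"
      unfolding sum_distrib_left[symmetric] sum_lessThan_telescope[of "\<lambda>i. m (t i)" n] by (simp only: t0 tn)
    also have "\<dots> = inverse (real (Suc k)) * (K * (b - a) * (m b - m a))"
      by (simp add: n_def divide_inverse mult_ac)
    finally show ?thesis .
  qed
  moreover have "(\<lambda>k. inverse (real (Suc k)) * (K * (b - a) * (m b - m a))) \<longlonglongrightarrow> 0 * (K * (b - a) * (m b - m a))"
    by (intro tendsto_intros LIMSEQ_inverse_real_of_nat)
  ultimately have "\<bar>\<phi> b - \<phi> a\<bar> \<le> 0 * (K * (b - a) * (m b - m a))"
    by (intro LIMSEQ_le_const[of _ _ "\<bar>\<phi> b - \<phi> a\<bar>"]) auto
  then show ?thesis by simp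
qed

context nonneg_selfadjoint
begin

lemma mu_neg: "AE x in \<mu> f. 0 \<le> x"
proof -
  have "emeasure (\<mu> f) {.. - inverse (real (Suc n))} = 0" for n
    by (simp add: finite_measure.emeasure_eq_measure[OF finite_measure_mu] mu_Iic F_neg)
  then have "{.. - inverse (real (Suc n))} \<in> null_sets (\<mu> f)" for n by (simp add: null_sets_def)
  then have "AE x in \<mu> f. \<forall>n. x \<notin> {.. - inverse (real (Suc n))}"
    by (simp add: AE_all_countable AE_not_in del: atMost_iff)
  then show ?thesis
  proof (rule AE_mp, intro AE_I2 impI)
    fix x assume x: "\<forall>n. x \<notin> {.. - inverse (real (Suc n))}"
    show "0 \<le> x"
    proof (rule ccontr)
      assume "\<not> 0 \<le> x"
      then obtain n where "inverse (real (Suc n)) < - x" using reals_Archimedean[of "- x"] by auto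
      moreover have "- inverse (real (Suc n)) < x" using x by (simp add: not_le)
      ultimately show False by simp
    qed
  qed
qed

text \<open>
  Let \<open>\<Phi>\<close> be a function whose increment over \<open>(a,b]\<close> lies between \<open>g a\<close> and \<open>g b\<close> times the measure of
  \<open>(a,b]\<close>. The integral of \<open>g\<close> has the same property, so both agree. It is applied with
  \<open>\<Phi> a = (H F a f | F a f)\<close> and with \<open>\<Phi> a = \<parallel>H F a f\<parallel>\<^sup>2\<close>.
\<close>

lemma spectral_integral:
  fixes g \<Phi> :: "real \<Rightarrow> real"
  assumes g: "g \<in> borel_measurable borel" "g 0 = 0" "\<And>x y. 0 \<le> x \<Longrightarrow> x \<le> y \<Longrightarrow> g x \<le> g y"
    and lip: "\<And>N. 0 \<le> N \<Longrightarrow> \<exists>K. \<forall>x y. 0 \<le> x \<longrightarrow> x \<le> y \<longrightarrow> y \<le> N \<longrightarrow> g y - g x \<le> K * (y - x)"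
    and \<Phi>0: "\<Phi> 0 = 0"
    and \<Phi>: "\<And>a b. 0 \<le> a \<Longrightarrow> a \<le> b \<Longrightarrow> 
        g a * (norm (F b f - F a f))\<^sup>2 \<le> \<Phi> b - \<Phi> a \<and> \<Phi> b - \<Phi> a \<le> g b * (norm (F b f - F a f))\<^sup>2"
    and N: "0 \<le> N"
  shows "integrable (\<mu> f) (\<lambda>x. indicator {0..N} x * g x)"
    and "(\<integral>x. indicator {0..N} x * g x \<partial>\<mu> f) = \<Phi> N"
proof -
  interpret finite_measure "\<mu> f" by (rule finite_measure_mu)
  have gpos: "0 \<le> g x" if "0 \<le> x" for x using g(2) g(3)[of 0 x] that by simp
  have int: "integrable (\<mu> f) (\<lambda>x. indicator {0..b} x * g x)" if "0 \<le> b" for b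
  proof (rule integrable_const_bound[of _ "g b"])
    show "AE x in \<mu> f. norm (indicator {0..b} x * g x) \<le> g b"
      using that g(3) gpos by (intro AE_I2) (auto simp: indicator_def)
  qed (use g(1) in simp)
  from int[OF N] show "integrable (\<mu> f) (\<lambda>x. indicator {0..N} x * g x)" .
  define h where "h b = (\<integral>x. indicator {0..b} x * g x \<partial>\<mu> f)" for b
  have h0: "h 0 = 0"
  proof -
    have "(\<lambda>x. indicator {0..0} x * g x) = (\<lambda>x::real. 0)" using g(2) by (auto simp: indicator_def)
    then show ?thesis unfolding h_def by simp
  qed
  have meas: "measure (\<mu> f) {a<..b} = (norm (F b f - F a f))\<^sup>2" if "a \<le> b" for a b
  proof -
    have "{a<..b} = {..b} - {..a}" by auto
    then show ?thesis
      using that by (simp add: finite_measure_Diff mu_Iic F_norm_diff)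
  qed
  have h_diff: "g a * (norm (F b f - F a f))\<^sup>2 \<le> h b - h a \<and> h b - h a \<le> g b * (norm (F b f - F a f))\<^sup>2"
    if ab: "0 \<le> a" "a \<le> b" for a b
  proof -
    have b: "0 \<le> b" using ab by simp
    have "h b - h a = (\<integral>x. indicator {0..b} x * g x - indicator {0..a} x * g x \<partial>\<mu> f)"
      unfolding h_def by (rule Bochner_Integration.integral_diff[symmetric]) (intro int ab b)+
    also have "(\<lambda>x. indicator {0..b} x * g x - indicator {0..a} x * g x) = (\<lambda>x. indicator {a<..b} x * g x)"
      using ab by (auto simp: indicator_def fun_eq_iff)
    finally have eq: "h b - h a = (\<integral>x. indicator {a<..b} x * g x \<partial>\<mu> f)" .
    have int2: "integrable (\<mu> f) (\<lambda>x. indicator {a<..b} x * g x)"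
      by (rule integrable_const_bound[of _ "g b"])
        (use ab b g gpos in \<open>auto simp: indicator_def intro!: AE_I2\<close>)
    have const: "(\<integral>x. indicator {a<..b} x * c \<partial>\<mu> f) = c * (norm (F b f - F a f))\<^sup>2"
      "integrable (\<mu> f) (\<lambda>x. indicator {a<..b} x * c)" for c :: real
      using meas[OF ab(2)] by (simp_all add: less_top[symmetric])
    have "(\<integral>x. indicator {a<..b} x * g a \<partial>\<mu> f) \<le> (\<integral>x. indicator {a<..b} x * g x \<partial>\<mu> f)"
      by (rule integral_mono[OF const(2) int2]) (use ab g(3) in \<open>auto simp: indicator_def\<close>)
    moreover have "(\<integral>x. indicator {a<..b} x * g x \<partial>\<mu> f) \<le> (\<integral>x. indicator {a<..b} x * g b \<partial>\<mu> f)"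
      by (rule integral_mono[OF int2 const(2)]) (use ab g(3) in \<open>auto simp: indicator_def\<close>)
    ultimately show ?thesis unfolding eq const by simp
  qed
  obtain K where K: "\<And>x y. 0 \<le> x \<Longrightarrow> x \<le> y \<Longrightarrow> y \<le> N \<Longrightarrow> g y - g x \<le> K * (y - x)"
    using lip[OF N] by blast
  have "h N - \<Phi> N = h 0 - \<Phi> 0"
  proof (rule constant_of_increment_bound[OF N])
    fix x y assume xy: "0 \<le> x" "x \<le> y" "y \<le> N"
    let ?d = "(norm (F y f - F x f))\<^sup>2"
    have "\<bar>(h y - \<Phi> y) - (h x - \<Phi> x)\<bar> \<le> g y * ?d - g x * ?d"
      using h_diff[OF xy(1,2)] \<Phi>[OF xy(1,2)] by linarith
    also have "\<dots> \<le> K * (y - x) * ?d"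
      using mult_right_mono[OF K[OF xy], of ?d] by (simp add: algebra_simps)
    also have "?d = (norm (F y f))\<^sup>2 - (norm (F x f))\<^sup>2" by (rule F_norm_diff[OF xy(2)])
    finally show "\<bar>(h y - \<Phi> y) - (h x - \<Phi> x)\<bar> \<le> K * (y - x) * ((norm (F y f))\<^sup>2 - (norm (F x f))\<^sup>2)" .
  qed
  then show "(\<integral>x. indicator {0..N} x * g x \<partial>\<mu> f) = \<Phi> N" by (simp add: h0 \<Phi>0 flip: h_def)
qed

lemma H_zero: "H 0 = 0"
  using H_scaleR[of 0 0] subspace_0[OF subD] by simp

lemma H_F0: "H (F 0 f) = 0" and F_dom: "0 \<le> a \<Longrightarrow> F a f \<in> D"
  using L_bound[OF _ F_mem, of 0 f] L_bound[OF _ F_mem, of a f] by auto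

text \<open>
  The projection \<open>F a\<close> commutes with \<open>H\<close> and annihilates \<open>u f = F b f - F a f\<close>, hence the mixed terms
  vanish in the first three identities.
\<close>

lemma spectral_increment:
  assumes ab: "0 \<le> a" "a \<le> b"
  defines "u \<equiv> \<lambda>f. F b f - F a f"
  shows "inner (H (F b f)) (F b f) - inner (H (F a f)) (F a f) = inner (H (u f)) (u f)"
    and "(norm (H (F b f) - H (F a f)))\<^sup>2 = (norm (H (u f)))\<^sup>2"
    and "(norm (H (F b f)))\<^sup>2 - (norm (H (F a f)))\<^sup>2 = (norm (H (u f)))\<^sup>2"
    and "a * (norm (u f))\<^sup>2 \<le> inner (H (u f)) (u f)" "inner (H (u f)) (u f) \<le> b * (norm (u f))\<^sup>2"
    and "a\<^sup>2 * (norm (u f))\<^sup>2 \<le> (norm (H (u f)))\<^sup>2" "(norm (H (u f)))\<^sup>2 \<le> b\<^sup>2 * (norm (u f))\<^sup>2"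
proof -
  have b: "0 \<le> b" using ab by simp
  let ?u = "u f" and ?p = "F a f"
  have pD: "?p \<in> D" and uD: "?u \<in> D"
    unfolding u_def by (intro subspace_diff subD F_dom ab b)+
  have Fb: "F b f = ?p + ?u" by (simp add: u_def)
  have Fu: "F a ?u = 0" by (simp add: u_def linear_diff[OF linear_F] F_idem F_nested ab)
  have HFu: "F a (H ?u) = 0" using F_H(2)[OF uD, of a] by (simp add: Fu H_zero)
  have Hp: "H ?p = F a (H ?p)" using F_H(2)[OF pD, of a] by (simp add: F_idem)
  have orth: "inner (H ?p) z = 0" if "F a z = 0" for z
    by (subst Hp) (simp add: F_sym that)
  have 1: "inner (H ?p) ?u = 0" "inner (H ?u) ?p = 0" "inner (H ?p) (H ?u) = 0"
    using orth[OF Fu] orth[OF HFu] H_sym[OF uD pD] by (simp_all add: inner_commute)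
  show "inner (H (F b f)) (F b f) - inner (H ?p) ?p = inner (H ?u) ?u"
    unfolding Fb H_add[OF pD uD] by (simp add: inner_add_left inner_add_right 1)
  show "(norm (H (F b f) - H (F a f)))\<^sup>2 = (norm (H ?u))\<^sup>2"
    unfolding Fb H_add[OF pD uD] by simp
  show "(norm (H (F b f)))\<^sup>2 - (norm (H ?p))\<^sup>2 = (norm (H ?u))\<^sup>2"
    unfolding Fb H_add[OF pD uD] 
    by (simp add: power2_norm_eq_inner inner_add_left inner_add_right 1 inner_commute[of "H ?u" "H ?p"])
  show lower: "a * (norm ?u)\<^sup>2 \<le> inner (H ?u) ?u" by (rule lower_bound[OF ab(1) uD Fu])
  have "F b ?u = ?u" by (simp add: u_def linear_diff[OF linear_F] F_idem F_nested ab)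
  then have "?u \<in> L b" using F_mem[of b ?u] by simp
  from L_bound(2)[OF b this] have upper: "norm (H ?u) \<le> b * norm ?u" .
  have cs: "inner (H ?u) ?u \<le> norm (H ?u) * norm ?u" by (rule norm_cauchy_schwarz)
  also have "\<dots> \<le> b * norm ?u * norm ?u" by (intro mult_right_mono upper) simp
  finally show "inner (H ?u) ?u \<le> b * (norm ?u)\<^sup>2" by (simp add: power2_eq_square mult_ac)
  show "(norm (H ?u))\<^sup>2 \<le> b\<^sup>2 * (norm ?u)\<^sup>2"
    using power_mono[OF upper, of 2] by (simp add: power_mult_distrib)
  have "a * norm ?u \<le> norm (H ?u)"
  proof (cases "?u = 0")
    case False
    have "(a * norm ?u) * norm ?u \<le> norm (H ?u) * norm ?u"
      using order_trans[OF lower cs] by (simp add: power2_eq_square mult_ac)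
    then show ?thesis using False by simp
  qed simp
  from power_mono[OF this, of 2] show "a\<^sup>2 * (norm ?u)\<^sup>2 \<le> (norm (H ?u))\<^sup>2"
    using ab by (simp add: power_mult_distrib)
qed

lemma integral_id:
  assumes "0 \<le> N"
  shows "(\<integral>x. indicator {0..N} x * x \<partial>\<mu> f) = inner (H (F N f)) (F N f)"
  by (rule spectral_integral(2)[where \<Phi> = "\<lambda>N. inner (H (F N f)) (F N f)"])
    (use assms H_F0 in \<open>auto simp: spectral_increment intro: exI[of _ 1]\<close>)

lemma integral_square:
  assumes N: "0 \<le> N"
  shows "integrable (\<mu> f) (\<lambda>x. indicator {0..N} x * x\<^sup>2)" 
    and "(\<integral>x. indicator {0..N} x * x\<^sup>2 \<partial>\<mu> f) = (norm (H (F N f)))\<^sup>2"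
proof -
  have lip: "\<exists>K. \<forall>x y. 0 \<le> x \<longrightarrow> x \<le> y \<longrightarrow> y \<le> N \<longrightarrow> y\<^sup>2 - x\<^sup>2 \<le> K * (y - x)" for N :: real
  proof (intro exI allI impI)
    fix x y :: real assume "0 \<le> x" "x \<le> y" "y \<le> N"
    then have "(y + x) * (y - x) \<le> (2 * N) * (y - x)" by (intro mult_right_mono) auto
    then show "y\<^sup>2 - x\<^sup>2 \<le> (2 * N) * (y - x)" by (simp add: power2_eq_square algebra_simps)
  qed
  note * = spectral_integral[where g = "\<lambda>x. x\<^sup>2" and \<Phi> = "\<lambda>N. (norm (H (F N f)))\<^sup>2" and f = f and N = N]
  show "integrable (\<mu> f) (\<lambda>x. indicator {0..N} x * x\<^sup>2)"
    by (rule *(1)) (use N H_F0 lip in \<open>auto simp: spectral_increment power_mono\<close>)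
  show "(\<integral>x. indicator {0..N} x * x\<^sup>2 \<partial>\<mu> f) = (norm (H (F N f)))\<^sup>2"
    by (rule *(2)) (use N H_F0 lip in \<open>auto simp: spectral_increment power_mono\<close>)
qed

lemma indicator_tendsto: "0 \<le> x \<Longrightarrow> (\<lambda>n. indicator {0..real n} x * g x) \<longlonglongrightarrow> (g x :: real)"
proof (rule tendsto_eventually)
  assume "0 \<le> x"
  moreover obtain k where "x \<le> real k" using real_arch_simple by blast
  ultimately show "\<forall>\<^sub>F n in sequentially. indicator {0..real n} x * g x = g x"
    by (auto simp: eventually_sequentially intro!: exI[of _ k])
qed

lemma integrable_square_of_mem:
  assumes f: "f \<in> D"
  shows "integrable (\<mu> f) (\<lambda>x. x\<^sup>2)"
proof (rule integrable_monotone_convergence)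
  show "integrable (\<mu> f) (\<lambda>x. indicator {0..real n} x * x\<^sup>2)" for n by (rule integral_square) simp
  show "AE x in \<mu> f. mono (\<lambda>n. indicator {0..real n} x * x\<^sup>2)"
    by (intro AE_I2) (auto simp: mono_def indicator_def)
  show "AE x in \<mu> f. (\<lambda>n. indicator {0..real n} x * x\<^sup>2) \<longlonglongrightarrow> x\<^sup>2"
    using mu_neg by (rule AE_mp) (intro AE_I2 impI indicator_tendsto)
  have "(\<lambda>n. (norm (F (real n) (H f)))\<^sup>2) \<longlonglongrightarrow> (norm (H f))\<^sup>2"
    by (intro tendsto_intros F_tendsto)
  then show "(\<lambda>n. \<integral>x. indicator {0..real n} x * x\<^sup>2 \<partial>\<mu> f) \<longlonglongrightarrow> (norm (H f))\<^sup>2"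
    by (simp add: integral_square F_H f)
qed simp

text \<open>
  If the second moment is finite, then \<open>H (F n f)\<close> converges, and \<open>f\<close> belongs to \<open>D\<close> since \<open>H\<close> is closed.
\<close>

lemma mem_of_integrable_square:
  assumes int: "integrable (\<mu> f) (\<lambda>x. x\<^sup>2)"
  shows "f \<in> D"
proof -
  have bd: "(norm (H (F (real n) f)))\<^sup>2 \<le> (\<integral>x. x\<^sup>2 \<partial>\<mu> f)" for n
    unfolding integral_square(2)[OF of_nat_0_le_iff, symmetric]
    by (rule integral_mono[OF integral_square(1) int]) (auto simp: indicator_def)
  have inc: "(norm (H (F (real n) f) - H (F (real m) f)))\<^sup>2 = (norm (H (F (real n) f)))\<^sup>2 - (norm (H (F (real m) f)))\<^sup>2"
    if "m \<le> n" for m n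
    using spectral_increment(2,3)[of "real m" "real n" f] that by simp
  have "incseq (\<lambda>n. (norm (H (F (real n) f)))\<^sup>2)"
    unfolding incseq_def
  proof (intro allI impI)
    fix m n :: nat assume "m \<le> n"
    from inc[OF this] show "(norm (H (F (real m) f)))\<^sup>2 \<le> (norm (H (F (real n) f)))\<^sup>2"
      using zero_le_power2[of "norm (H (F (real n) f) - H (F (real m) f))"] by linarith
  qed
  then have "convergent (\<lambda>n. (norm (H (F (real n) f)))\<^sup>2)"
    using incseq_convergent[of "\<lambda>n. (norm (H (F (real n) f)))\<^sup>2"] bd unfolding convergent_def by metis
  then have "convergent (\<lambda>n. H (F (real n) f))"
    by (rule convergent_of_norm_diff) (metis inc norm_minus_commute abs_minus_commute abs_of_nonneg zero_le_power2)
  then obtain h where h: "(\<lambda>n. H (F (real n) f)) \<longlonglongrightarrow> h" by (auto simp: convergent_def)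
  show ?thesis
  proof (rule adjointI(1))
    fix k assume k: "k \<in> D"
    show "inner (H k) f = inner k h"
    proof (rule LIMSEQ_unique)
      show "(\<lambda>n. inner (H k) (F (real n) f)) \<longlonglongrightarrow> inner (H k) f" by (intro tendsto_intros F_tendsto)
      show "(\<lambda>n. inner (H k) (F (real n) f)) \<longlonglongrightarrow> inner k h"
        unfolding H_sym[OF k F_dom[OF of_nat_0_le_iff]] by (intro tendsto_intros h)
    qed
  qed
qed

lemma integral_mu:
  assumes f: "f \<in> D"
  shows "(\<integral>x. x \<partial>\<mu> f) = inner (H f) f"
proof (rule LIMSEQ_unique)
  interpret finite_measure "\<mu> f" by (rule finite_measure_mu)
  show "(\<lambda>n. \<integral>x. indicator {0..real n} x * x \<partial>\<mu> f) \<longlonglongrightarrow> (\<integral>x. x \<partial>\<mu> f)"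
  proof (rule integral_dominated_convergence)
    show "integrable (\<mu> f) (\<lambda>x. 1 + x\<^sup>2)" by (intro Bochner_Integration.integrable_add integrable_square_of_mem f) simp
    show "AE x in \<mu> f. (\<lambda>n. indicator {0..real n} x * x) \<longlonglongrightarrow> x"
      using mu_neg by (rule AE_mp) (intro AE_I2 impI indicator_tendsto)
    show "AE x in \<mu> f. norm (indicator {0..real n} x * x) \<le> 1 + x\<^sup>2" for n
    proof (rule AE_I2)
      fix x :: real
      have "2 * \<bar>x\<bar> \<le> 1 + x\<^sup>2" using zero_le_power2[of "\<bar>x\<bar> - 1"] by (simp add: power2_eq_square algebra_simps)
      then show "norm (indicator {0..real n} x * x) \<le> 1 + x\<^sup>2" by (auto simp: indicator_def)
    qed
  qed auto
  have "(\<lambda>n. inner (F (real n) (H f)) (F (real n) f)) \<longlonglongrightarrow> inner (H f) f" by (intro tendsto_intros F_tendsto)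
  then show "(\<lambda>n. \<integral>x. indicator {0..real n} x * x \<partial>\<mu> f) \<longlonglongrightarrow> inner (H f) f"
    by (simp add: integral_id F_H f)
qed

lemma cinner_H_same:
  assumes f: "f \<in> D"
  shows "cinner (H f) f = complex_of_real (inner (H f) f)"
proof (rule complex_eqI)
  have "inner (\<i> *\<^sub>C H f) f = inner (\<i> *\<^sub>C f) (H f)"
    using H_sym[OF D_scaleC[OF f] f, of "\<i>"] by (simp add: H_scaleC f)
  also have "\<dots> = - inner f (\<i> *\<^sub>C H f)"
    by (simp add: inner_eq_Re_cinner cinner_scaleC_left cinner_scaleC_right)
  finally show "Im (cinner (H f) f) = Im (complex_of_real (inner (H f) f))"
    by (simp add: Im_cinner inner_commute)
qed (simp add: Re_cinner)

theorem is_spectral_measure_Q: "is_spectral_measure D H Q"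
  unfolding is_spectral_measure_def scalar_measure_Q
  using projection_valued_measure_Q integrable_square_of_mem mem_of_integrable_square cinner_H_same integral_mu
  by auto

end

section \<open>Consequences of a spectral measure\<close>

context
  fixes E :: "real set \<Rightarrow> 'a::complex_hilbert \<Rightarrow> 'a"
  assumes pvm: "projection_valued_measure E"
begin

lemma pvm_proj: "B \<in> sets borel \<Longrightarrow> orthogonal_projection (E B)"
  and pvm_UNIV: "E UNIV f = f"
  and pvm_sums: "range A \<subseteq> sets borel \<Longrightarrow> disjoint_family A \<Longrightarrow> (\<lambda>n. E (A n) f) sums E (\<Union>n::nat. A n) f"
  using pvm by (auto simp: projection_valued_measure_def)

lemma pvm_empty: "E {} f = 0"
proof -
  have "(\<lambda>n::nat. E {} f) sums E {} f"
    using pvm_sums[of "\<lambda>_. {}" f] by (simp add: disjoint_family_on_def)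
  then show ?thesis by (metis sums_summable summable_const_iff)
qed

lemma pvm_Un:
  assumes A: "A \<in> sets borel" and B: "B \<in> sets borel" and disj: "A \<inter> B = {}"
  shows "E (A \<union> B) f = E A f + E B f"
proof -
  have "(\<lambda>n. E (binaryset A B n) f) sums E (\<Union>n. binaryset A B n) f"
    using A B disj by (intro pvm_sums) (auto simp: range_binaryset_eq disjoint_family_on_def binaryset_def)
  moreover have "(\<lambda>n. E (binaryset A B n) f) sums (E A f + E B f)"
    by (rule binaryset_sums[of "\<lambda>B. E B f"]) (rule pvm_empty)
  ultimately show ?thesis by (metis sums_unique2 UN_binaryset_eq)
qed

lemma pvm_compl: "B \<in> sets borel \<Longrightarrow> E (- B) f = f - E B f"
  using pvm_Un[of B "- B" f] by (simp add: pvm_UNIV algebra_simps)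

lemma sets_scalar [simp, measurable_cong]: "sets (scalar_measure E f) = sets borel"
  and space_scalar [simp]: "space (scalar_measure E f) = UNIV"
  unfolding scalar_measure_def 
  by (simp_all add: sets_measure_of space_measure_of) (metis sets.sigma_sets_eq space_borel)

lemma emeasure_scalar:
  assumes B: "B \<in> sets borel"
  shows "emeasure (scalar_measure E f) B = ennreal ((norm (E B f))\<^sup>2)"
proof -
  have nn: "Re (cinner (E B f) f) = (norm (E B f))\<^sup>2" if "B \<in> sets borel" for B
    by (simp add: Re_cinner proj_norm[OF pvm_proj[OF that]])
  have "emeasure (scalar_measure E f) B = ennreal (Re (cinner (E B f) f))"
    unfolding scalar_measure_def
  proof (rule emeasure_measure_of_sigma)
    show "sigma_algebra UNIV (sets (borel :: real measure))" by (metis sets.sigma_algebra_axioms space_borel)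
    show "positive (sets borel) (\<lambda>B. ennreal (Re (cinner (E B f) f)))"
      by (simp add: positive_def pvm_empty Re_cinner)
    show "countably_additive (sets borel) (\<lambda>B. ennreal (Re (cinner (E B f) f)))"
      unfolding countably_additive_def
    proof (intro allI impI)
      fix A :: "nat \<Rightarrow> real set" assume A: "range A \<subseteq> sets borel" "disjoint_family A"
      have "(\<lambda>i. inner (E (A i) f) f) sums inner (E (\<Union>i. A i) f) f"
        by (rule bounded_linear.sums[OF bounded_linear_inner_left pvm_sums[OF A]])
      then show "(\<Sum>i. ennreal (Re (cinner (E (A i) f) f))) = ennreal (Re (cinner (E (\<Union> (range A)) f) f))"
        unfolding Re_cinner[symmetric] using A nn by (intro suminf_ennreal_eq) auto
    qed
  qed (rule B)
  then show ?thesis by (simp add: nn B)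
qed

lemma finite_scalar: "finite_measure (scalar_measure E f)"
  by (rule finite_measureI) (simp add: emeasure_scalar)

lemma measure_scalar: "B \<in> sets borel \<Longrightarrow> measure (scalar_measure E f) B = (norm (E B f))\<^sup>2"
  by (simp add: measure_def emeasure_scalar)

lemma AE_scalar_mem:
  assumes B: "B \<in> sets borel" and f: "E B f = f"
  shows "AE x in scalar_measure E f. x \<in> B"
proof (rule AE_I)
  show "emeasure (scalar_measure E f) (- B) = 0" 
    using B f by (simp add: emeasure_scalar pvm_compl)
qed (use B in auto)

end

context
  fixes D :: "'a::complex_hilbert set" and H :: "'a \<Rightarrow> 'a" and E :: "real set \<Rightarrow> 'a \<Rightarrow> 'a"
  assumes sm: "is_spectral_measure D H E" and ge0: "op_ge D H 0"
begin

lemma spectral_pvm: "projection_valued_measure E"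
  using sm by (simp add: is_spectral_measure_def)

lemma spectral_form: "f \<in> D \<Longrightarrow> inner (H f) f = (\<integral>x. x \<partial>scalar_measure E f)"
  using sm by (simp add: is_spectral_measure_def flip: Re_cinner)

lemma integrable_id_scalar:
  assumes "f \<in> D"
  shows "integrable (scalar_measure E f) (\<lambda>x. x)"
proof (rule Bochner_Integration.integrable_bound)
  interpret finite_measure "scalar_measure E f" by (rule finite_scalar[OF spectral_pvm])
  have "integrable (scalar_measure E f) (\<lambda>x. x\<^sup>2)" using sm assms by (auto simp: is_spectral_measure_def)
  then show "integrable (scalar_measure E f) (\<lambda>x. 1 + x\<^sup>2)" by simp
  show "AE x in scalar_measure E f. norm x \<le> norm (1 + x\<^sup>2)"
  proof (rule AE_I2)
    fix x :: real
    have "2 * \<bar>x\<bar> \<le> 1 + x\<^sup>2" using zero_le_power2[of "\<bar>x\<bar> - 1"] by (simp add: power2_eq_square algebra_simps)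
    then show "norm x \<le> norm (1 + x\<^sup>2)" by simp
  qed
qed (simp add: sets_scalar[OF spectral_pvm] cong: measurable_cong_sets)

text \<open>The range of \<open>E {a..b}\<close> consists of vectors of the domain, on which \<open>H \<le> b\<close>.\<close>

lemma spectral_bounded_range:
  assumes f: "E {a..b} f = f"
  shows "f \<in> D" "inner (H f) f \<le> b * (norm f)\<^sup>2"
proof -
  interpret finite_measure "scalar_measure E f" by (rule finite_scalar[OF spectral_pvm])
  note [measurable_cong] = sets_scalar[OF spectral_pvm]
  have AE: "AE x in scalar_measure E f. x \<in> {a..b}" by (rule AE_scalar_mem[OF spectral_pvm _ f]) simp
  have "integrable (scalar_measure E f) (\<lambda>x. x\<^sup>2)"
  proof (rule integrable_const_bound[of _ "(max \<bar>a\<bar> \<bar>b\<bar>)\<^sup>2"])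
    show "AE x in scalar_measure E f. norm (x\<^sup>2) \<le> (max \<bar>a\<bar> \<bar>b\<bar>)\<^sup>2"
      using AE
    proof (rule AE_mp, intro AE_I2 impI)
      fix x assume "x \<in> {a..b}"
      then have "\<bar>x\<bar> \<le> max \<bar>a\<bar> \<bar>b\<bar>" by auto
      from power_mono[OF this, of 2] show "norm (x\<^sup>2) \<le> (max \<bar>a\<bar> \<bar>b\<bar>)\<^sup>2" by simp
    qed
  qed measurable
  then show fD: "f \<in> D" using sm by (auto simp: is_spectral_measure_def)
  have "(\<integral>x. x \<partial>scalar_measure E f) \<le> (\<integral>x. b \<partial>scalar_measure E f)"
    by (rule integral_mono_AE[OF integrable_id_scalar[OF fD]]) (use AE in auto)
  also have "\<dots> = b * (norm f)\<^sup>2"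
    by (simp add: space_scalar[OF spectral_pvm] measure_scalar[OF spectral_pvm] pvm_UNIV[OF spectral_pvm])
  finally show "inner (H f) f \<le> b * (norm f)\<^sup>2" by (simp add: spectral_form[OF fD])
qed

text \<open>
  A spectral measure of \<open>H \<ge> 0\<close> vanishes on \<open>(-\<infinity>,0)\<close>: on the range of \<open>E {-n..-1/(n+1)}\<close> the form of \<open>H\<close>
  is both nonnegative and at most \<open>- 1 / (n + 1)\<close>.
\<close>

lemma spectral_nonneg: "AE x in scalar_measure E f. 0 \<le> x"
proof -
  let ?B = "\<lambda>n. {- real n .. - inverse (real (Suc n))}"
  have "emeasure (scalar_measure E f) (?B n) = 0" for n
  proof -
    let ?g = "E (?B n) f"
    have "E (?B n) ?g = ?g" by (rule proj_idem[OF pvm_proj[OF spectral_pvm]]) simp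
    from spectral_bounded_range[OF this] 
    have "?g \<in> D" "inner (H ?g) ?g \<le> - inverse (real (Suc n)) * (norm ?g)\<^sup>2" by auto
    moreover from this(1) have "0 \<le> inner (H ?g) ?g" using ge0 by (auto simp: op_ge_def Re_cinner)
    ultimately have "inverse (real (Suc n)) * (norm ?g)\<^sup>2 \<le> 0" by linarith
    then have "(norm ?g)\<^sup>2 \<le> 0" by (simp add: mult_le_0_iff)
    then show ?thesis by (simp add: emeasure_scalar[OF spectral_pvm])
  qed
  then have "?B n \<in> null_sets (scalar_measure E f)" for n
    by (simp add: null_sets_def sets_scalar[OF spectral_pvm])
  then have "AE x in scalar_measure E f. \<forall>n. x \<notin> ?B n"
    unfolding AE_all_countable by (intro allI AE_not_in)
  then show ?thesis
  proof (rule AE_mp, intro AE_I2 impI)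
    fix x assume x: "\<forall>n. x \<notin> ?B n"
    show "0 \<le> x"
    proof (rule ccontr)
      assume neg: "\<not> 0 \<le> x"
      then obtain k where k: "inverse (real (Suc k)) < - x" using reals_Archimedean[of "- x"] by auto
      obtain l where l: "- x \<le> real l" using real_arch_simple by blast
      have "inverse (real (Suc (max k l))) \<le> inverse (real (Suc k))" by (intro le_imp_inverse_le) auto
      moreover have "real l \<le> real (max k l)" by simp
      ultimately have "x \<in> ?B (max k l)" using k l unfolding atLeastAtMost_iff by linarith
      then show False using x by blast
    qed
  qed
qed

text \<open>On the range of \<open>1 - E {0..b}\<close> the spectral measure is carried by \<open>(b,\<infinity>)\<close>.\<close>

lemma spectral_lower_bound:
  assumes fD: "f \<in> D" and b: "0 \<le> b"
  shows "b * (norm (f - E {0..b} f))\<^sup>2 \<le> inner (H f) f"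
proof -
  interpret finite_measure "scalar_measure E f" by (rule finite_scalar[OF spectral_pvm])
  note [measurable_cong] = sets_scalar[OF spectral_pvm]
  have meas: "- {0..b} \<in> sets borel" by simp
  have "b * (norm (f - E {0..b} f))\<^sup>2 = (\<integral>x. indicator (- {0..b}) x * b \<partial>scalar_measure E f)"
    using meas by (simp add: measure_scalar[OF spectral_pvm] pvm_compl[OF spectral_pvm] space_scalar[OF spectral_pvm])
  also have "\<dots> \<le> (\<integral>x. x \<partial>scalar_measure E f)"
  proof (rule integral_mono_AE)
    show "integrable (scalar_measure E f) (\<lambda>x. indicator (- {0..b}) x * b)"
      by (rule integrable_const_bound[of _ b]) (use b in \<open>auto simp: indicator_def\<close>)
    show "AE x in scalar_measure E f. indicator (- {0..b}) x * b \<le> x"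
      using spectral_nonneg by (rule AE_mp) (use b in \<open>auto simp: indicator_def\<close>)
  qed (rule integrable_id_scalar[OF fD])
  finally show ?thesis by (simp add: spectral_form[OF fD])
qed

end

lemma spectral_projector_obtain:
  assumes "selfadjoint D H" "op_ge D H 0"
  obtains E where "is_spectral_measure D H E" "\<And>B. spectral_projector D H B = E B"
proof
  interpret nonneg_selfadjoint D H by unfold_locales (rule assms)+
  show "is_spectral_measure D H (SOME Q. is_spectral_measure D H Q)"
    by (rule someI[of "is_spectral_measure D H"]) (rule is_spectral_measure_Q)
qed (simp add: spectral_projector_def)

section \<open>Strict positivity of a sum\<close>

lemma bounded_op_ge_compression_iff:
  assumes P: "orthogonal_projection P"
  shows "bounded_op_ge (P \<circ> V \<circ> P) (\<lambda>f. \<kappa> *\<^sub>R P f) 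
    \<longleftrightarrow> (\<forall>f. \<kappa> * (norm (P f))\<^sup>2 \<le> inner (V (P f)) (P f))"
proof -
  have "Re (cinner (P (V (P f)) - \<kappa> *\<^sub>R P f) f) = inner (V (P f)) (P f) - \<kappa> * (norm (P f))\<^sup>2" for f
    by (simp add: Re_cinner inner_diff_left proj_sym[OF P, of "V (P f)"] proj_norm[OF P])
  then show ?thesis by (simp add: bounded_op_ge_def op_ge_def)
qed

text \<open>The difference of the two sides is half the value of the form of \<open>V\<close> at \<open>u + 2 g\<close>.\<close>

lemma psd_split:
  fixes V :: "'a::real_inner \<Rightarrow> 'a"
  assumes lin: "linear V" and sym: "\<And>x y. inner (V x) y = inner x (V y)" and pos: "\<And>x. 0 \<le> inner (V x) x"
  shows "inner (V u) u / 2 - inner (V g) g \<le> inner (V (u + g)) (u + g)"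
proof -
  have "0 \<le> inner (V (u + 2 *\<^sub>R g)) (u + 2 *\<^sub>R g)" by (rule pos)
  also have "\<dots> = inner (V u) u + 4 * inner (V u) g + 4 * inner (V g) g"
    using sym[of g u] by (simp add: linear_add[OF lin] linear_cmul[OF lin] inner_add_left inner_add_right inner_commute)
  finally have "0 \<le> inner (V u) u + 4 * inner (V u) g + 4 * inner (V g) g" .
  moreover have "inner (V (u + g)) (u + g) = inner (V u) u + 2 * inner (V u) g + inner (V g) g"
    using sym[of g u] by (simp add: linear_add[OF lin] inner_add_left inner_add_right inner_commute)
  ultimately show ?thesis by linarith
qed

theorem theorem2p1:
  fixes D :: "'a::complex_hilbert set"
    and H V :: "'a \<Rightarrow> 'a"
    and P :: "real \<Rightarrow> 'a \<Rightarrow> 'a"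
  assumes "selfadjoint D H" and "op_ge D H 0"
    and "bounded_selfadjoint V" and "op_ge UNIV V 0"
  defines "P \<equiv> \<lambda>E. spectral_projector D H {0..E}"
  shows "(strictly_positive D (\<lambda>f. H f + V f)
            \<longleftrightarrow> (\<exists>E1>0. \<exists>\<kappa>>0. bounded_op_ge (P E1 \<circ> V \<circ> P E1) (\<lambda>f. \<kappa> *\<^sub>R P E1 f)))
       \<and> ((\<exists>E1>0. \<exists>\<kappa>>0. bounded_op_ge (P E1 \<circ> V \<circ> P E1) (\<lambda>f. \<kappa> *\<^sub>R P E1 f))
            \<longleftrightarrow> (\<exists>E2>0. \<exists>\<mu>>0. \<forall>f\<in>D. Re (cinner (H f) f) \<le> E2 * (norm f)\<^sup>2
                    \<longrightarrow> Re (cinner (V f) f) \<ge> \<mu> * (norm f)\<^sup>2))"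
    (is "(?i \<longleftrightarrow> ?ii) \<and> (?ii \<longleftrightarrow> ?iii)")
proof -
  obtain Q where Q: "is_spectral_measure D H Q" and P_eq: "P E = Q {0..E}" for E
    unfolding P_def by (rule spectral_projector_obtain[OF assms(1,2)]) blast
  have P_proj: "orthogonal_projection (P E)" for E
    unfolding P_eq by (rule pvm_proj[OF spectral_pvm[OF Q assms(2)]]) simp
  have blV: "bounded_linear V" using assms(3) by (simp add: bounded_selfadjoint_def)
  have linV: "linear V" by (rule bounded_linear.linear[OF blV])
  have symV: "inner (V x) y = inner x (V y)" for x y by (rule bounded_selfadjoint_sym_inner[OF assms(3)])
  have posV: "0 \<le> inner (V x) x" for x using assms(4) by (simp add: op_ge_def Re_cinner)
  have ii_eq: "?ii \<longleftrightarrow> (\<exists>E1>0. \<exists>\<kappa>>0. \<forall>f. \<kappa> * (norm (P E1 f))\<^sup>2 \<le> inner (V (P E1 f)) (P E1 f))"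
    by (simp add: bounded_op_ge_compression_iff[OF P_proj])

  have "?iii" if i: "?i"
  proof -
    obtain \<epsilon> where \<epsilon>: "0 < \<epsilon>" "\<And>f. f \<in> D \<Longrightarrow> \<epsilon> * (norm f)\<^sup>2 \<le> inner (H f) f + inner (V f) f"
      using i by (auto simp: strictly_positive_def op_ge_def Re_cinner inner_add_left)
    show ?thesis
    proof (intro exI conjI ballI impI)
      fix f assume "f \<in> D" "Re (cinner (H f) f) \<le> \<epsilon> / 2 * (norm f)\<^sup>2"
      then show "\<epsilon> / 2 * (norm f)\<^sup>2 \<le> Re (cinner (V f) f)"
        using \<epsilon>(2)[of f] by (simp add: Re_cinner)
    qed (use \<epsilon> in auto)
  qed
  moreover have "?ii" if iii: "?iii"
  proof -
    obtain E \<mu> where E: "0 < E" "0 < \<mu>" and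
      V: "\<And>f. f \<in> D \<Longrightarrow> inner (H f) f \<le> E * (norm f)\<^sup>2 \<Longrightarrow> \<mu> * (norm f)\<^sup>2 \<le> inner (V f) f"
      using iii by (auto simp: Re_cinner)
    have "\<mu> * (norm (P E f))\<^sup>2 \<le> inner (V (P E f)) (P E f)" for f
    proof -
      have "Q {0..E} (P E f) = P E f" using proj_idem[OF P_proj, of E f] by (simp add: P_eq)
      from spectral_bounded_range[OF Q assms(2) this] show ?thesis by (rule V)
    qed
    then show ?thesis unfolding ii_eq using E by blast
  qed
  moreover have "?i" if ii: "?ii"
  proof -
    obtain b \<kappa> where b: "0 < b" "0 < \<kappa>" and
      V: "\<And>f. \<kappa> * (norm (P b f))\<^sup>2 \<le> inner (V (P b f)) (P b f)"
      using ii unfolding ii_eq by blast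
    obtain c where c: "0 < c" "\<And>x. norm (V x) \<le> norm x * c" using bounded_linear.pos_bounded[OF blV] by blast
    have Vc: "inner (V x) x \<le> c * (norm x)\<^sup>2" for x
      using norm_cauchy_schwarz[of "V x" x] mult_right_mono[OF c(2)[of x], of "norm x"]
      by (simp add: power2_eq_square mult_ac)
    \<comment> \<open>only the fraction \<open>s V\<close> of \<open>V\<close> is used, so small that \<open>H\<close> controls it above the energy \<open>b\<close>\<close>
    define s where "s = min 1 (b / (2 * c))"
    have s: "0 < s" "s \<le> 1" "s * c \<le> b / 2" using b c by (auto simp: s_def min_def field_simps)
    define \<epsilon> where "\<epsilon> = min (b / 2) (s * \<kappa> / 2)"
    have \<epsilon>: "0 < \<epsilon>" "\<epsilon> \<le> b / 2" "\<epsilon> \<le> s * \<kappa> / 2" using b s by (auto simp: \<epsilon>_def)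
    have "\<epsilon> * (norm f)\<^sup>2 \<le> inner (H f) f + inner (V f) f" if f: "f \<in> D" for f
    proof -
      let ?u = "P b f" and ?g = "f - P b f"
      have "\<kappa> * (norm ?u)\<^sup>2 / 2 - c * (norm ?g)\<^sup>2 \<le> inner (V f) f"
        using psd_split[OF linV symV posV, of ?u ?g] V[of f] Vc[of ?g] by simp
      from mult_left_mono[OF this, of s] 
      have "(s * \<kappa> / 2) * (norm ?u)\<^sup>2 - (s * c) * (norm ?g)\<^sup>2 \<le> s * inner (V f) f"
        using s by (simp add: algebra_simps)
      moreover have "s * inner (V f) f \<le> inner (V f) f"
        using mult_right_mono[OF s(2) posV[of f]] by simp
      moreover have "(s * c) * (norm ?g)\<^sup>2 \<le> b / 2 * (norm ?g)\<^sup>2"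
        using s by (intro mult_right_mono) auto
      moreover have "b * (norm ?g)\<^sup>2 \<le> inner (H f) f"
        using spectral_lower_bound[OF Q assms(2) f, of b] b by (simp add: P_eq)
      moreover have "\<epsilon> * (norm ?u)\<^sup>2 \<le> (s * \<kappa> / 2) * (norm ?u)\<^sup>2" "\<epsilon> * (norm ?g)\<^sup>2 \<le> b / 2 * (norm ?g)\<^sup>2"
        using \<epsilon> by (intro mult_right_mono; simp)+
      moreover have "\<epsilon> * (norm f)\<^sup>2 = \<epsilon> * (norm ?u)\<^sup>2 + \<epsilon> * (norm ?g)\<^sup>2"
        using proj_pythagoras[OF P_proj, of f b] by (simp add: distrib_left)
      ultimately show ?thesis by linarith
    qed
    then show ?thesis using \<epsilon>(1) by (auto simp: strictly_positive_def op_ge_def Re_cinner inner_add_left)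
  qed
  ultimately show ?thesis by blast
qed

end
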